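(* Let $q$ be a prime power, $s\ge2$, the bases $\mathfrak{B}_{m,i}$ be as in the context, and let $\boldsymbol{\alpha}=(\alpha_1,\ldots,\alpha_s)\in Y^s$. A hyperplane sequence $\mathcal{S}_{\boldsymbol{\alpha}}$ over $\mathbb{F}_q$ associated with $\boldsymbol{\alpha}$ is uniformly distributed modulo one if and only if $\alpha_1,\ldots,\alpha_s$ are linearly independent over $\mathbb{F}_q[x]$ (as elements of $\mathbb{F}_q[[x]]$).
   Context: $\mathbb{F}_q$ is the finite field with $q$ elements; $\varphi:\{0,\ldots,q-1\}\to\mathbb{F}_q$ is a fixed bijection with $\varphi(0)=0$. For $m\in\mathbb{N}$, $R_m=\mathbb{F}_q[x]/(x^m)$ (elements identified with polynomials of degree $<m$). For each $i=1,\ldots,s$ and $m\in\mathbb{N}$ an ordered basis $\mathfrak{B}_{m,i}=\{\mathfrak{b}_{m,i,1},\ldots,\mathfrak{b}_{m,i,m}\}$ of $R_m$ over $\mathbb{F}_q$ is fixed such that for $1\le j\le m$ the coefficient vector of $\mathfrak{b}_{m+1,i,j}$ w.r.t. $\{1,\ldots,x^m\}$ equals that of $\mathfrak{b}_{m,i,j}$ w.r.t. $\{1,\ldots,x^{m-1}\}$ with a $0$ appended. $\theta_m:R_m^s\to\mathbb{F}_q^{sm}$ sends $(k_1,\ldots,k_s)$ to the concatenation of the coordinate vectors of $k_i$ w.r.t. $\mathfrak{B}_{m,i}$. $Y=\{\alpha\in\mathbb{F}_q[[x]]:\gcd(\alpha\bmod x^m,x^m)=1\ \forall m\}$; for $\boldsymbol{\alpha}\in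 Y^s$, $\boldsymbol{\alpha}^{(m)}$ is the coordinatewise reduction mod $x^m$. $\mathcal{N}'_{\boldsymbol{\alpha}^{(m)}}=\{\mathbf{k}\in R_m^s:\sum_i\alpha^{(m)}_ik_i\equiv0\pmod{x^m}\}$, $\mathcal{N}_{\boldsymbol{\alpha}^{(m)}}=\theta_m(\mathcal{N}'_{\boldsymbol{\alpha}^{(m)}})$. Digital sequences: given $C_1,\ldots,C_s\in\mathbb{F}_q^{\mathbb{N}\times\mathbb{N}}$, for $k=\sum_{j\ge0}\kappa_jq^j\in\mathbb{N}_0$ put $\vec k=(\varphi(\kappa_0),\varphi(\kappa_1),\ldots)^\top$, $C_i\vec k=(y_{i,1}(k),y_{i,2}(k),\ldots)^\top$, $x_{k,i}=\sum_{j\ge1}\varphi^{-1}(y_{i,j}(k))q^{-j}$, $\boldsymbol{x}_k=(x_{k,1},\ldots,x_{k,s})$. Let $C_i^{(m)}$ be the upper-left $m\times m$ submatrix of $C_i$ and $C^{(m)}=(C_1^{(m)\top}\cdots C_s^{(m)\top})\in\mathbb{F}_q^{m\times sm}$. A hyperplane sequence associated with $\boldsymbol{\alpha}$ is the sequence $(\boldsymbol{x}_k)_{k\ge0}$ of a digital sequence whose generating matrices satisfy, for every $m\in\mathbb{N}$, that the row space of $C^{(m)}$ equals the orthogonal complement of $\mathcal{N}_{\boldsymbol{\alpha}^{(m)}}$ in $\mathbb{F}_q^{sm}$ w.r.t. the standard inner product. *)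

theory Defs
  imports
    Complex_Main
    "HOL-Library.Cardinality"
    "HOL-Library.FuncSet"
    "HOL-Computational_Algebra.Polynomial_FPS"
    "HOL-Number_Theory.Cong"
    "Jordan_Normal_Form.VS_Connect"
begin

text \<open>
  The field with \<open>q\<close> elements is a type \<open>'a :: {field, finite}\<close>, with \<open>q = CARD('a)\<close>.
  The index ranges \<open>i = 1..s\<close>, \<open>j = 1..m\<close> and the positions in vectors and matrices are all
  shifted to start at \<open>0\<close>; the parameter \<open>m\<close> itself is not shifted and ranges over \<open>m \<ge> 1\<close>.
\<close>

interpretation poly_vs: vector_space "Polynomial.smult :: 'a::field \<Rightarrow> 'a poly \<Rightarrow> 'a poly"
  by unfold_locales (simp_all add: smult_add_right smult_add_left)

text \<open>The ring \<open>R\<^sub>m\<close>, as polynomials of degree less than \<open>m\<close>.\<close>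

definition trunc_polys :: "nat \<Rightarrow> 'a::field poly set" where
  "trunc_polys m = {p. p = 0 \<or> degree p < m}"

definition ordered_basis :: "nat \<Rightarrow> (nat \<Rightarrow> 'a::field poly) \<Rightarrow> bool" where
  "ordered_basis m b \<longleftrightarrow>
     inj_on b {..<m} \<and> poly_vs.independent (b ` {..<m}) \<and>
     poly_vs.span (b ` {..<m}) = trunc_polys m"

definition compatible_bases :: "nat \<Rightarrow> (nat \<Rightarrow> nat \<Rightarrow> nat \<Rightarrow> 'a::field poly) \<Rightarrow> bool" where
  "compatible_bases s \<BB> \<longleftrightarrow>
     (\<forall>m\<ge>1. \<forall>i<s. ordered_basis m (\<BB> m i)) \<and>
     (\<forall>m\<ge>1. \<forall>i<s. \<forall>j<m.
        map (coeff (\<BB> (Suc m) i j)) [0..<Suc m] = map (coeff (\<BB> m i j)) [0..<m] @ [0])"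

definition coord :: "nat \<Rightarrow> (nat \<Rightarrow> 'a::field poly) \<Rightarrow> 'a poly \<Rightarrow> nat \<Rightarrow> 'a" where
  "coord m b p j = poly_vs.representation (b ` {..<m}) p (b j)"

text \<open>In a concatenation of \<open>s\<close> blocks of length \<open>m\<close>, position \<open>l\<close> is entry \<open>l mod m\<close> of block
  \<open>l div m\<close>.\<close>

definition theta ::
  "nat \<Rightarrow> (nat \<Rightarrow> nat \<Rightarrow> nat \<Rightarrow> 'a::field poly) \<Rightarrow> nat \<Rightarrow> (nat \<Rightarrow> 'a poly) \<Rightarrow> 'a vec" where
  "theta s \<BB> m k = vec (s * m) (\<lambda>l. coord m (\<BB> m (l div m)) (k (l div m)) (l mod m))"

definition unit_series :: "'a::field fps set" where
  "unit_series = {\<alpha>. \<forall>m\<ge>1. coprime (truncate_fps m \<alpha>) (monom 1 m)}"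

definition hyperplane_polys :: "nat \<Rightarrow> (nat \<Rightarrow> 'a::field fps) \<Rightarrow> nat \<Rightarrow> (nat \<Rightarrow> 'a poly) set" where
  "hyperplane_polys s \<alpha> m =
     {k \<in> {..<s} \<rightarrow>\<^sub>E trunc_polys m.
        [(\<Sum>i<s. truncate_fps m (\<alpha> i) * k i) = 0] (mod monom 1 m)}"

definition hyperplane_space ::
  "nat \<Rightarrow> (nat \<Rightarrow> nat \<Rightarrow> nat \<Rightarrow> 'a::field poly) \<Rightarrow> (nat \<Rightarrow> 'a fps) \<Rightarrow> nat \<Rightarrow> 'a vec set" where
  "hyperplane_space s \<BB> \<alpha> m = theta s \<BB> m ` hyperplane_polys s \<alpha> m"

text \<open>\<open>C i r c\<close> is the entry in row \<open>r\<close> and column \<open>c\<close> of the \<open>i\<close>-th generating matrix.\<close>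

definition upper_left :: "nat \<Rightarrow> (nat \<Rightarrow> nat \<Rightarrow> 'a) \<Rightarrow> 'a mat" where
  "upper_left m A = mat m m (\<lambda>(r, c). A r c)"

definition overall_mat :: "nat \<Rightarrow> (nat \<Rightarrow> nat \<Rightarrow> nat \<Rightarrow> 'a) \<Rightarrow> nat \<Rightarrow> 'a mat" where
  "overall_mat s C m =
     mat m (s * m) (\<lambda>(r, l). transpose_mat (upper_left m (C (l div m))) $$ (r, l mod m))"

definition digit_vec :: "(nat \<Rightarrow> 'a::{field,finite}) \<Rightarrow> nat \<Rightarrow> nat \<Rightarrow> 'a" where
  "digit_vec \<phi> k c = \<phi> (k div CARD('a) ^ c mod CARD('a))"

text \<open>The sum runs over the support of the digit vector, which is finite whenever \<open>\<phi> 0 = 0\<close>.\<close>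

definition mat_digit ::
  "(nat \<Rightarrow> 'a::{field,finite}) \<Rightarrow> (nat \<Rightarrow> nat \<Rightarrow> 'a) \<Rightarrow> nat \<Rightarrow> nat \<Rightarrow> 'a" where
  "mat_digit \<phi> A k j = (\<Sum>c | digit_vec \<phi> k c \<noteq> 0. A j c * digit_vec \<phi> k c)"

definition digital_sequence ::
  "(nat \<Rightarrow> 'a::{field,finite}) \<Rightarrow> (nat \<Rightarrow> nat \<Rightarrow> nat \<Rightarrow> 'a) \<Rightarrow> nat \<Rightarrow> nat \<Rightarrow> real" where
  "digital_sequence \<phi> C k i =
     (\<Sum>j. real (inv_into {..<CARD('a)} \<phi> (mat_digit \<phi> (C i) k j)) / real CARD('a) ^ Suc j)"

definition hyperplane_sequence ::
  "nat \<Rightarrow> (nat \<Rightarrow> 'a::{field,finite}) \<Rightarrow> (nat \<Rightarrow> nat \<Rightarrow> nat \<Rightarrow> 'a poly) \<Rightarrow> (nat \<Rightarrow> 'a fps) \<Rightarrow>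
   (nat \<Rightarrow> nat \<Rightarrow> real) \<Rightarrow> bool" where
  "hyperplane_sequence s \<phi> \<BB> \<alpha> X \<longleftrightarrow>
     (\<exists>C. (\<forall>m\<ge>1. vec_space.row_space (s * m) (overall_mat s C m) =
                   vec_module.orthogonal_complement (s * m) (hyperplane_space s \<BB> \<alpha> m)) \<and>
          (\<forall>k. \<forall>i<s. X k i = digital_sequence \<phi> C k i))"

definition uniformly_distributed_mod1 :: "nat \<Rightarrow> (nat \<Rightarrow> nat \<Rightarrow> real) \<Rightarrow> bool" where
  "uniformly_distributed_mod1 s X \<longleftrightarrow>
     (\<forall>a b. (\<forall>i<s. 0 \<le> a i \<and> a i < b i \<and> b i \<le> 1) \<longrightarrow>
        (\<lambda>N. real (card {k. k < N \<and> (\<forall>i<s. frac (X k i) \<in> {a i..<b i})}) / real N)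
          \<longlonglongrightarrow> (\<Prod>i<s. b i - a i))"

definition lin_indep_over_polys :: "nat \<Rightarrow> (nat \<Rightarrow> 'a::field fps) \<Rightarrow> bool" where
  "lin_indep_over_polys s \<alpha> \<longleftrightarrow>
     (\<forall>p. (\<Sum>i<s. fps_of_poly (p i) * \<alpha> i) = 0 \<longrightarrow> (\<forall>i<s. p i = 0))"

end

theory Submission
  imports Defs
begin

text \<open>
  A vector \<open>h\<close> is orthogonal to all rows of \<open>C\<^sup>(\<^sup>m\<^sup>)\<close> for every large \<open>m\<close> iff the polynomials
  \<open>k\<^sub>i = \<Sum>\<^sub>j h\<^sub>i\<^sub>j b\<^sub>i\<^sub>j\<close> satisfy \<open>\<Sum>\<^sub>i \<alpha>\<^sub>i k\<^sub>i = 0\<close> modulo every \<open>x\<^sup>m\<close>, hence exactly. So the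
  \<open>\<alpha>\<^sub>i\<close> are independent over the polynomials iff the (infinite) rows of all \<open>C\<^sub>i\<close> together are
  independent over the field. A linear relation among finitely many rows forces a linear relation
  among the leading digits of all points, so some elementary box is never hit. If the rows are
  independent, they have dual vectors of finite support; adding these to the digit vector of \<open>k\<close>
  permutes each block of \<open>q\<^sup>M\<close> consecutive indices and carries any pattern of leading digits to any
  other, so all patterns are equally frequent in every block.
\<close>

section \<open>Row relations and polynomial relations\<close>

lemma sum_lessThan_mult:
  fixes f :: "nat \<Rightarrow> 'b::comm_monoid_add"
  shows "(\<Sum>l<s * m. f l) = (\<Sum>i<s. \<Sum>j<m. f (i * m + j))"
proof -
  have "(\<Sum>l<s * m. f l) = (\<Sum>i<s. sum f {i * m..<i * m + m})"
    by (rule sum.nat_group[symmetric])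
  also have "\<dots> = (\<Sum>i<s. \<Sum>j<m. f (i * m + j))"
  proof (rule sum.cong[OF refl])
    fix i
    show "sum f {i * m..<i * m + m} = (\<Sum>j<m. f (i * m + j))"
      using sum.shift_bounds_nat_ivl[of f 0 "i * m" m]
      by (simp add: atLeast0LessThan add.commute)
  qed
  finally show ?thesis .
qed

section \<open>Coordinates in ordered bases and the nesting of the bases\<close>

lemma ordered_basis_sum_coord:
  assumes "ordered_basis m b" and "p \<in> trunc_polys m"
  shows "(\<Sum>j<m. Polynomial.smult (coord m b p j) (b j)) = p"
proof -
  have inj: "inj_on b {..<m}" and ind: "poly_vs.independent (b ` {..<m})"
    and sp: "p \<in> poly_vs.span (b ` {..<m})"
    using assms by (auto simp: ordered_basis_def)
  have "(\<Sum>v\<in>b ` {..<m}. Polynomial.smult (poly_vs.representation (b ` {..<m}) p v) v) = p"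
    by (rule poly_vs.sum_representation_eq[OF ind sp]) auto
  then show ?thesis
    by (simp add: sum.reindex[OF inj] coord_def)
qed

lemma ordered_basis_coord_sum:
  assumes b: "ordered_basis m b" and j: "j < m"
  shows "coord m b (\<Sum>i<m. Polynomial.smult (h i) (b i)) j = h j"
proof -
  have inj: "inj_on b {..<m}" and ind: "poly_vs.independent (b ` {..<m})"
    using b by (auto simp: ordered_basis_def)
  \<comment> \<open>\<open>representation\<close> is indexed by basis elements rather than
    positions, so \<open>h\<close> is transported along the inverse of \<open>b\<close> and extended
    by 0.\<close>
  let ?f = "\<lambda>v. if v \<in> b ` {..<m} then h (the_inv_into {..<m} b v) else 0"
  have f: "?f (b i) = h i" if "i < m" for i
    using that by (simp add: the_inv_into_f_f[OF inj])
  have "poly_vs.representation (b ` {..<m}) (\<Sum>i<m. Polynomial.smult (h i) (b i)) = ?f"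
  proof (rule poly_vs.representation_eqI[OF ind])
    show "(\<Sum>i<m. Polynomial.smult (h i) (b i)) \<in> poly_vs.span (b ` {..<m})"
      by (intro poly_vs.span_sum poly_vs.span_scale poly_vs.span_base) auto
    show "finite {v. ?f v \<noteq> 0}"
      by (rule finite_subset[of _ "b ` {..<m}"]) auto
    have "(\<Sum>v | ?f v \<noteq> 0. Polynomial.smult (?f v) v) = (\<Sum>v\<in>b ` {..<m}. Polynomial.smult (?f v) v)"
      by (rule sum.mono_neutral_left) auto
    also have "\<dots> = (\<Sum>i<m. Polynomial.smult (?f (b i)) (b i))"
      by (simp add: sum.reindex[OF inj])
    also have "\<dots> = (\<Sum>i<m. Polynomial.smult (h i) (b i))"
      by (rule sum.cong) (auto simp: the_inv_into_f_f[OF inj])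
    finally show "(\<Sum>v | ?f v \<noteq> 0. Polynomial.smult (?f v) v) = (\<Sum>i<m. Polynomial.smult (h i) (b i))" .
  qed (auto split: if_splits)
  then show ?thesis
    using f[OF j] by (simp add: coord_def)
qed

lemma ordered_basis_in_trunc_polys:
  assumes "ordered_basis m b" and "j < m"
  shows "b j \<in> trunc_polys m"
proof -
  have "b j \<in> poly_vs.span (b ` {..<m})"
    using assms(2) by (intro poly_vs.span_base) auto
  then show ?thesis
    using assms(1) by (simp add: ordered_basis_def)
qed

lemma trunc_polys_iff_coeff:
  assumes "m \<ge> 1"
  shows "p \<in> trunc_polys m \<longleftrightarrow> (\<forall>n\<ge>m. coeff p n = 0)"
proof
  assume "p \<in> trunc_polys m"
  then show "\<forall>n\<ge>m. coeff p n = 0"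
    by (auto simp: trunc_polys_def intro: coeff_eq_0)
next
  assume *: "\<forall>n\<ge>m. coeff p n = 0"
  show "p \<in> trunc_polys m"
  proof (cases "p = 0")
    case False
    then have "coeff p (degree p) \<noteq> 0"
      by simp
    then show ?thesis
      using * by (auto simp: trunc_polys_def not_le[symmetric])
  qed (simp add: trunc_polys_def)
qed

lemma trunc_polys_sum:
  assumes "m \<ge> 1" and "\<And>i. i \<in> I \<Longrightarrow> f i \<in> trunc_polys m"
  shows "(\<Sum>i\<in>I. Polynomial.smult (h i) (f i)) \<in> trunc_polys m"
  using assms by (auto simp: trunc_polys_iff_coeff Polynomial.coeff_sum intro!: sum.neutral)

text \<open>Appending a 0 to the coefficient vector does not change the polynomial, so the bases are
  nested. The \<open>j\<close>-th element first occurs at \<open>Suc j\<close>, hence the single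
  family \<open>\<BB> (Suc j) i j\<close> serves every \<open>m\<close>, which makes relations at
  different \<open>m\<close> comparable.\<close>

lemma compatible_bases_stable:
  assumes "compatible_bases s \<BB>" and "i < s" and "j < m"
  shows "\<BB> m i j = \<BB> (Suc j) i j"
proof -
  have step: "\<BB> (Suc n) i j = \<BB> n i j" if "j < n" for n
  proof -
    have n: "n \<ge> 1"
      using that by simp
    have ob: "ordered_basis n (\<BB> n i)" "ordered_basis (Suc n) (\<BB> (Suc n) i)"
      using assms(1,2) n by (auto simp: compatible_bases_def)
    have "map (coeff (\<BB> (Suc n) i j)) [0..<Suc n] = map (coeff (\<BB> n i j)) [0..<n] @ [0]"
      using assms(1,2) n that by (auto simp: compatible_bases_def)
    then have "\<forall>t<Suc n. coeff (\<BB> (Suc n) i j) t = (if t < n then coeff (\<BB> n i j) t else 0)"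
      by (simp add: list_eq_iff_nth_eq nth_append del: upt_Suc)
    then have eq: "\<forall>t<n. coeff (\<BB> (Suc n) i j) t = coeff (\<BB> n i j) t"
      and zero: "coeff (\<BB> (Suc n) i j) n = 0"
      by auto
    have "\<forall>t\<ge>n. coeff (\<BB> n i j) t = 0"
      using ordered_basis_in_trunc_polys[OF ob(1) that] n by (simp add: trunc_polys_iff_coeff)
    moreover have "\<forall>t\<ge>Suc n. coeff (\<BB> (Suc n) i j) t = 0"
      using ordered_basis_in_trunc_polys[OF ob(2), of j] that by (simp add: trunc_polys_iff_coeff)
    ultimately show ?thesis
      using eq zero by (intro poly_eqI) (metis le_antisym not_less not_less_eq_eq)
  qed
  have "Suc j \<le> m"
    using assms(3) by simp
  then show ?thesis
    by (induction m rule: dec_induct) (auto simp: step)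
qed

lemma ordered_basis_cong:
  assumes "\<And>j. j < m \<Longrightarrow> b j = b' j"
  shows "ordered_basis m b \<longleftrightarrow> ordered_basis m b'"
proof -
  have "b ` {..<m} = b' ` {..<m}" and "inj_on b {..<m} = inj_on b' {..<m}"
    using assms by (auto intro!: image_cong inj_on_cong)
  then show ?thesis
    by (simp add: ordered_basis_def)
qed

lemma coord_cong:
  assumes "\<And>j. j < m \<Longrightarrow> b j = b' j" and "j < m"
  shows "coord m b p j = coord m b' p j"
proof -
  have "b ` {..<m} = b' ` {..<m}"
    using assms by (auto intro!: image_cong)
  then show ?thesis
    using assms by (simp add: coord_def)
qed

lemma cong_monom_zero_iff_coeff:
  "[p = 0] (mod monom (1::'a::field) m) \<longleftrightarrow> (\<forall>t<m. coeff p t = 0)"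
  by (simp add: cong_0_iff monom_1_dvd_iff')

text \<open>Coefficient \<open>t\<close> of a product involves only coefficients up to
  \<open>t\<close>, so truncation at \<open>m > t\<close> is invisible. This links the congruences
  modulo \<open>x^m\<close> to an identity of power series.\<close>

lemma coeff_truncate_mult:
  assumes "t < m"
  shows "coeff (truncate_fps m \<alpha> * p) t = fps_nth (fps_of_poly p * \<alpha>) t"
  using assms by (simp add: coeff_mult fps_mult_nth mult.commute[of "fps_of_poly p"] atMost_atLeast0)

lemma scalar_prod_blocks:
  fixes v w :: "'a::semiring_0 vec"
  assumes "w \<in> carrier_vec (s * m)"
  shows "v \<bullet> w = (\<Sum>i<s. \<Sum>j<m. v $ (i * m + j) * w $ (i * m + j))"
  using assms by (simp add: scalar_prod_def atLeast0LessThan sum_lessThan_mult)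

lemma block_index_less:
  fixes i j :: nat
  assumes "i < s" and "j < m"
  shows "i * m + j < s * m"
proof -
  have "Suc i * m \<le> s * m"
    using assms(1) by (intro mult_le_mono1) simp
  then show ?thesis
    using assms(2) by simp
qed

lemma overall_mat_index:
  assumes "i < s" and "j < m" and "r < m"
  shows "row (overall_mat s C m) r $ (i * m + j) = C i j r"
  using assms block_index_less[OF assms(1,2)] by (simp add: overall_mat_def upper_left_def)

lemma theta_index:
  assumes "compatible_bases s \<BB>" and "i < s" and "j < m"
  shows "theta s \<BB> m k $ (i * m + j) = coord m (\<lambda>j. \<BB> (Suc j) i j) (k i) j"
proof -
  have "theta s \<BB> m k $ (i * m + j) = coord m (\<BB> m i) (k i) j"
    using block_index_less[OF assms(2,3)] assms by (simp add: theta_def)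
  also have "\<dots> = coord m (\<lambda>j. \<BB> (Suc j) i j) (k i) j"
    by (rule coord_cong) (use assms compatible_bases_stable in auto)
  finally show ?thesis .
qed

lemma ordered_basis_stable:
  assumes "compatible_bases s \<BB>" and "i < s" and "m \<ge> 1"
  shows "ordered_basis m (\<lambda>j. \<BB> (Suc j) i j)"
proof -
  have "ordered_basis m (\<BB> m i)"
    using assms by (simp add: compatible_bases_def)
  moreover have "\<BB> m i j = \<BB> (Suc j) i j" if "j < m" for j
    using compatible_bases_stable[OF assms(1,2) that] .
  ultimately show ?thesis
    using ordered_basis_cong[of m "\<BB> m i" "\<lambda>j. \<BB> (Suc j) i j"] by blast
qed

text \<open>The hyperplane space is cut out by the \<open>m\<close> vectors
  \<open>coeff (\<alpha>\<^sub>i b\<^sub>i\<^sub>j) t\<close>, which therefore lie in its orthogonal complement; this replaces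
  the duality \<open>W\<^sup>\<bottom>\<^sup>\<bottom> = W\<close>.\<close>

lemma orthogonal_rows_iff_hyperplane:
  fixes C :: "nat \<Rightarrow> nat \<Rightarrow> nat \<Rightarrow> 'a::field"
  assumes m: "m \<ge> 1" and compat: "compatible_bases s \<BB>"
    and space: "vec_space.row_space (s * m) (overall_mat s C m) =
      vec_module.orthogonal_complement (s * m) (hyperplane_space s \<BB> \<alpha> m)"
    and v: "v \<in> carrier_vec (s * m)"
  shows "(\<forall>r<m. v \<bullet> row (overall_mat s C m) r = 0) \<longleftrightarrow>
    (\<forall>t<m. coeff (\<Sum>i<s. truncate_fps m (\<alpha> i) *
       (\<Sum>j<m. Polynomial.smult (v $ (i * m + j)) (\<BB> (Suc j) i j))) t = 0)"
    (is "?L \<longleftrightarrow> ?R")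
proof -
  interpret vec_space "TYPE('a)" "s * m" .
  \<comment> \<open>The tuple of polynomials with coordinate vector \<open>v\<close>; it is
    restricted to \<open>{..<s}\<close> because \<open>hyperplane_polys\<close> consists of
    extensional functions.\<close>
  define K where "K = (\<lambda>i\<in>{..<s}. \<Sum>j<m. Polynomial.smult (v $ (i * m + j)) (\<BB> (Suc j) i j))"
  have ob: "ordered_basis m (\<lambda>j. \<BB> (Suc j) i j)" if "i < s" for i
    using ordered_basis_stable[OF compat that m] .
  have theta_K: "theta s \<BB> m K = v"
  proof (rule eq_vecI)
    show "dim_vec (theta s \<BB> m K) = dim_vec v"
      using v by (simp add: theta_def)
    fix l assume "l < dim_vec v"
    then have l: "l < s * m"
      using v by simp
    define i j where "i = l div m" and "j = l mod m"
    have i: "i < s" and j: "j < m" and lij: "l = i * m + j"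
      using l m by (auto simp: i_def j_def less_mult_imp_div_less)
    show "theta s \<BB> m K $ l = v $ l"
      unfolding lij theta_index[OF compat i j]
      using ordered_basis_coord_sum[OF ob[OF i] j] i by (simp add: K_def)
  qed
  have K_mem: "K \<in> {..<s} \<rightarrow>\<^sub>E trunc_polys m"
    unfolding K_def using ob ordered_basis_in_trunc_polys[OF ob] m
    by (auto intro!: trunc_polys_sum)
  have rows: "set (rows (overall_mat s C m)) \<subseteq> carrier_vec (s * m)"
    by (auto simp: rows_def overall_mat_def)
  have row_carrier: "row (overall_mat s C m) r \<in> carrier_vec (s * m)" for r
    by (simp add: overall_mat_def row_def)
  have row_mem: "row (overall_mat s C m) r \<in> row_space (overall_mat s C m)" if "r < m" for r
  proof -
    have "row (overall_mat s C m) r \<in> set (rows (overall_mat s C m))"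
      using that by (auto simp: rows_def overall_mat_def)
    then show ?thesis
      unfolding row_space_def using in_own_span[OF rows] by blast
  qed
  have sumK: "(\<Sum>i<s. truncate_fps m (\<alpha> i) *
       (\<Sum>j<m. Polynomial.smult (v $ (i * m + j)) (\<BB> (Suc j) i j))) =
      (\<Sum>i<s. truncate_fps m (\<alpha> i) * K i)"
    by (simp add: K_def)
  show ?thesis
  proof
    assume ?R
    then have "K \<in> hyperplane_polys s \<alpha> m"
      using K_mem unfolding sumK by (simp add: hyperplane_polys_def cong_monom_zero_iff_coeff)
    then have vN: "v \<in> hyperplane_space s \<BB> \<alpha> m"
      using theta_K by (auto simp: hyperplane_space_def)
    show ?L
    proof (intro allI impI)
      fix r assume "r < m"
      then have "row (overall_mat s C m) r \<bullet> v = 0"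
        using row_mem vN unfolding space by (auto simp: orthogonal_complement_def)
      then show "v \<bullet> row (overall_mat s C m) r = 0"
        using comm_scalar_prod[OF v row_carrier] by simp
    qed
  next
    assume L: ?L
    have "v \<in> orthogonal_complement (set (rows (overall_mat s C m)))"
      using L v by (auto simp: orthogonal_complement_def rows_def overall_mat_def)
    \<comment> \<open>Orthogonality to the rows extends to their span, so \<open>v\<close> is
      orthogonal to every vector that can be placed in the row space.\<close>
    then have v_perp: "v \<in> orthogonal_complement (row_space (overall_mat s C m))"
      unfolding row_space_def using in_orthogonal_complement_span[OF rows] by simp
    show ?R
    proof (intro allI impI)
      fix t assume t: "t < m"
      define a where "a = vec (s * m) (\<lambda>l. coeff (truncate_fps m (\<alpha> (l div m)) *
        \<BB> (Suc (l mod m)) (l div m) (l mod m)) t)"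
      have a_carrier: "a \<in> carrier_vec (s * m)"
        by (simp add: a_def)
      have a_index: "a $ (i * m + j) = coeff (truncate_fps m (\<alpha> i) * \<BB> (Suc j) i j) t"
        if "i < s" "j < m" for i j
        using that block_index_less[OF that] by (simp add: a_def)
      \<comment> \<open>Pairing with \<open>a\<close> reads off coefficient \<open>t\<close> of the
        combination with coordinates \<open>h\<close>. It is applied to the elements
        \<open>w\<close> of the hyperplane space, where the coefficient vanishes, and then to
        \<open>v\<close>.\<close>
      have eval: "(\<Sum>i<s. \<Sum>j<m. h i j * a $ (i * m + j)) =
        coeff (\<Sum>i<s. truncate_fps m (\<alpha> i) * (\<Sum>j<m. Polynomial.smult (h i j) (\<BB> (Suc j) i j))) t" for h
        by (simp add: Polynomial.coeff_sum sum_distrib_left a_index)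
      have "a \<bullet> w = 0" if "w \<in> hyperplane_space s \<BB> \<alpha> m" for w
      proof -
        from that obtain k where k: "k \<in> hyperplane_polys s \<alpha> m" and w: "w = theta s \<BB> m k"
          by (auto simp: hyperplane_space_def)
        have w_carrier: "w \<in> carrier_vec (s * m)"
          by (simp add: w theta_def)
        have "a \<bullet> w = (\<Sum>i<s. \<Sum>j<m. w $ (i * m + j) * a $ (i * m + j))"
          by (simp add: scalar_prod_blocks[OF w_carrier] mult.commute)
        also have "\<dots> = coeff (\<Sum>i<s. truncate_fps m (\<alpha> i) * k i) t"
          unfolding eval
        proof (intro arg_cong2[where f = coeff] sum.cong refl arg_cong2[where f = "(*)"])
          fix i assume "i \<in> {..<s}"
          then have i: "i < s" by simp
          have "k i \<in> trunc_polys m"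
            using k i by (auto simp: hyperplane_polys_def)
          from ordered_basis_sum_coord[OF ob[OF i] this]
          show "(\<Sum>j<m. Polynomial.smult (w $ (i * m + j)) (\<BB> (Suc j) i j)) = k i"
            by (simp add: w theta_index[OF compat i])
        qed
        also have "\<dots> = 0"
          using k t by (simp add: hyperplane_polys_def cong_monom_zero_iff_coeff)
        finally show ?thesis .
      qed
      then have "a \<in> row_space (overall_mat s C m)"
        unfolding space using a_carrier by (simp add: orthogonal_complement_def)
      then have "v \<bullet> a = 0"
        using v_perp by (simp add: orthogonal_complement_def)
      then show "coeff (\<Sum>i<s. truncate_fps m (\<alpha> i) *
          (\<Sum>j<m. Polynomial.smult (v $ (i * m + j)) (\<BB> (Suc j) i j))) t = 0"
        by (simp only: scalar_prod_blocks[OF a_carrier] eval)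
    qed
  qed
qed

text \<open>For each large \<open>m\<close>, the orthogonality criterion compares the first
  \<open>m\<close> columns of the row relation with the first \<open>m\<close> coefficients of the
  series. Letting \<open>m\<close> grow yields the relation of infinite rows on one side and an
  exact identity in the power series ring on the other.\<close>

lemma row_relation_iff_poly_relation:
  fixes C :: "nat \<Rightarrow> nat \<Rightarrow> nat \<Rightarrow> 'a::field"
  assumes compat: "compatible_bases s \<BB>"
    and space: "\<forall>m\<ge>1. vec_space.row_space (s * m) (overall_mat s C m) =
      vec_module.orthogonal_complement (s * m) (hyperplane_space s \<BB> \<alpha> m)"
  shows "(\<forall>c. (\<Sum>i<s. \<Sum>j<l. h i j * C i j c) = 0) \<longleftrightarrow>
    (\<Sum>i<s. fps_of_poly (\<Sum>j<l. Polynomial.smult (h i j) (\<BB> (Suc j) i j)) * \<alpha> i) = 0"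
proof -
  define P where "P i = (\<Sum>j<l. Polynomial.smult (h i j) (\<BB> (Suc j) i j))" for i
  have main: "(\<forall>r<m. (\<Sum>i<s. \<Sum>j<l. h i j * C i j r) = 0) \<longleftrightarrow>
      (\<forall>t<m. fps_nth (\<Sum>i<s. fps_of_poly (P i) * \<alpha> i) t = 0)" if m: "m \<ge> 1" "m \<ge> l" for m
  proof -
    \<comment> \<open>The array \<open>h\<close> has blocks of length \<open>l\<close>; each block
      is padded with zeros to length \<open>m\<close>.\<close>
    define v where "v = vec (s * m) (\<lambda>x. if x mod m < l then h (x div m) (x mod m) else 0)"
    have v: "v \<in> carrier_vec (s * m)"
      by (simp add: v_def)
    have v_index: "v $ (i * m + j) = (if j < l then h i j else 0)" if "i < s" "j < m" for i j
      using that block_index_less[OF that] by (simp add: v_def)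
    have pad: "(\<Sum>j<m. if j < l then g j else 0) = (\<Sum>j<l. g j)" for g :: "nat \<Rightarrow> 'b::comm_monoid_add"
      using m by (intro sum.mono_neutral_cong_right) auto
    have "v \<bullet> row (overall_mat s C m) r = (\<Sum>i<s. \<Sum>j<l. h i j * C i j r)" if "r < m" for r
    proof -
      have "row (overall_mat s C m) r \<in> carrier_vec (s * m)"
        by (simp add: overall_mat_def row_def)
      then have "v \<bullet> row (overall_mat s C m) r =
        (\<Sum>i<s. \<Sum>j<m. v $ (i * m + j) * row (overall_mat s C m) r $ (i * m + j))"
        by (rule scalar_prod_blocks)
      also have "\<dots> = (\<Sum>i<s. \<Sum>j<m. if j < l then h i j * C i j r else 0)"
        by (intro sum.cong refl) (simp add: v_index overall_mat_index that del: index_row)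
      finally show ?thesis
        by (simp add: pad)
    qed
    moreover have "(\<Sum>j<m. Polynomial.smult (v $ (i * m + j)) (\<BB> (Suc j) i j)) = P i" if "i < s" for i
    proof -
      have "(\<Sum>j<m. Polynomial.smult (v $ (i * m + j)) (\<BB> (Suc j) i j)) =
        (\<Sum>j<m. if j < l then Polynomial.smult (h i j) (\<BB> (Suc j) i j) else 0)"
        using that by (intro sum.cong) (auto simp: v_index)
      then show ?thesis
        by (simp add: pad P_def)
    qed
    moreover have "vec_space.row_space (s * m) (overall_mat s C m) =
      vec_module.orthogonal_complement (s * m) (hyperplane_space s \<BB> \<alpha> m)"
      using space m by simp
    ultimately show ?thesis
      using orthogonal_rows_iff_hyperplane[OF m(1) compat _ v, of C \<alpha>]
      by (simp add: Polynomial.coeff_sum coeff_truncate_mult fps_sum_nth)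
  qed
  \<comment> \<open>A property of all indices can be tested on arbitrarily long initial segments;
    this is used for the columns and for the coefficients.\<close>
  have eventually: "(\<forall>c. Q c) \<longleftrightarrow> (\<forall>m. m \<ge> 1 \<and> m \<ge> l \<longrightarrow> (\<forall>r<m. Q r))" for Q :: "nat \<Rightarrow> bool"
  proof
    assume *: "\<forall>m. m \<ge> 1 \<and> m \<ge> l \<longrightarrow> (\<forall>r<m. Q r)"
    have "Q c" for c
      using *[rule_format, of "Suc (max c l)" c] by simp
    then show "\<forall>c. Q c" ..
  qed simp
  have "(\<forall>c. (\<Sum>i<s. \<Sum>j<l. h i j * C i j c) = 0) \<longleftrightarrow>
      (\<forall>m. m \<ge> 1 \<and> m \<ge> l \<longrightarrow> (\<forall>r<m. (\<Sum>i<s. \<Sum>j<l. h i j * C i j r) = 0))"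
    by (rule eventually)
  also have "\<dots> \<longleftrightarrow> (\<forall>m. m \<ge> 1 \<and> m \<ge> l \<longrightarrow>
      (\<forall>t<m. fps_nth (\<Sum>i<s. fps_of_poly (P i) * \<alpha> i) t = 0))"
    using main by blast
  also have "\<dots> \<longleftrightarrow> (\<forall>t. fps_nth (\<Sum>i<s. fps_of_poly (P i) * \<alpha> i) t = 0)"
    by (rule eventually[symmetric])
  also have "\<dots> \<longleftrightarrow> (\<Sum>i<s. fps_of_poly (P i) * \<alpha> i) = 0"
    by (simp only: fps_eq_iff fps_zero_nth)
  finally show ?thesis
    by (simp only: P_def)
qed

text \<open>Arrays \<open>h\<close> of width \<open>l\<close> and tuples of polynomials of degree
  below \<open>l\<close> determine each other through the bases, so trivial relations on one side
  correspond to trivial relations on the other.\<close>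

lemma rows_independent_iff_lin_indep:
  fixes C :: "nat \<Rightarrow> nat \<Rightarrow> nat \<Rightarrow> 'a::field"
  assumes compat: "compatible_bases s \<BB>"
    and space: "\<forall>m\<ge>1. vec_space.row_space (s * m) (overall_mat s C m) =
      vec_module.orthogonal_complement (s * m) (hyperplane_space s \<BB> \<alpha> m)"
  shows "(\<forall>l h. (\<forall>c. (\<Sum>i<s. \<Sum>j<l. h i j * C i j c) = 0) \<longrightarrow> (\<forall>i<s. \<forall>j<l. h i j = 0)) \<longleftrightarrow>
    lin_indep_over_polys s \<alpha>" (is "?L \<longleftrightarrow> _")
proof
  assume L: ?L
  show "lin_indep_over_polys s \<alpha>"
    unfolding lin_indep_over_polys_def
  proof (intro allI impI)
    fix p i assume rel: "(\<Sum>i<s. fps_of_poly (p i) * \<alpha> i) = 0" and i: "i < s"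
    \<comment> \<open>One degree bound for all \<open>p i\<close>, so that the whole tuple has
      coordinates in bases of the same length.\<close>
    define m where "m = Suc (Max (degree ` p ` {..<s}))"
    have m: "m \<ge> 1"
      by (simp add: m_def)
    have p: "p i \<in> trunc_polys m" if "i < s" for i
      using that by (auto simp: trunc_polys_def m_def less_Suc_eq_le)
    define h where "h i j = coord m (\<lambda>j. \<BB> (Suc j) i j) (p i) j" for i j
    have sum_h: "(\<Sum>j<m. Polynomial.smult (h i j) (\<BB> (Suc j) i j)) = p i" if "i < s" for i
      unfolding h_def
      by (rule ordered_basis_sum_coord[OF ordered_basis_stable[OF compat that m] p[OF that]])
    have "\<forall>c. (\<Sum>i<s. \<Sum>j<m. h i j * C i j c) = 0"
      unfolding row_relation_iff_poly_relation[OF compat space] using rel by (simp add: sum_h)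
    then have "\<forall>j<m. h i j = 0"
      using L i by blast
    then show "p i = 0"
      using sum_h[OF i] by simp
  qed
next
  assume R: "lin_indep_over_polys s \<alpha>"
  show ?L
  proof (intro allI impI)
    fix l h i j
    assume rel: "\<forall>c. (\<Sum>i<s. \<Sum>j<l. h i j * C i j c) = 0" and i: "i < s" and j: "j < l"
    define p where "p i = (\<Sum>j<l. Polynomial.smult (h i j) (\<BB> (Suc j) i j))" for i
    have "(\<Sum>i<s. fps_of_poly (p i) * \<alpha> i) = 0"
      using rel row_relation_iff_poly_relation[OF compat space] by (simp add: p_def)
    then have "p i = 0"
      using R i unfolding lin_indep_over_polys_def by blast
    have ob: "ordered_basis l (\<lambda>j. \<BB> (Suc j) i j)"
      using ordered_basis_stable[OF compat i] j by simp
    have "h i j = coord l (\<lambda>j. \<BB> (Suc j) i j) (p i) j"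
      using ordered_basis_coord_sum[OF ob j] by (simp add: p_def)
    also have "p i = (\<Sum>j<l. Polynomial.smult 0 (\<BB> (Suc j) i j))"
      using \<open>p i = 0\<close> by simp
    also have "coord l (\<lambda>j. \<BB> (Suc j) i j) \<dots> j = 0"
      using ordered_basis_coord_sum[OF ob j, of "\<lambda>_. 0"] by simp
    finally show "h i j = 0" .
  qed
qed

section \<open>Dual vectors\<close>

text \<open>The functional that an infinite row \<open>w\<close> defines on vectors \<open>v\<close>
  of finite support. Summing over the support of \<open>v\<close> matches the form of
  \<open>mat_digit\<close>.\<close>

definition lin_form :: "(nat \<Rightarrow> 'a::field) \<Rightarrow> (nat \<Rightarrow> 'a) \<Rightarrow> 'a" where
  "lin_form w v = (\<Sum>c | v c \<noteq> 0. w c * v c)"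

lemma lin_form_eq_sum:
  assumes "finite S" and "{c. v c \<noteq> 0} \<subseteq> S"
  shows "lin_form w v = (\<Sum>c\<in>S. w c * v c)"
  unfolding lin_form_def using assms by (intro sum.mono_neutral_left) auto

lemma lin_form_add:
  assumes "finite {c. u c \<noteq> 0}" and "finite {c. v c \<noteq> 0}"
  shows "lin_form w (\<lambda>c. u c + v c) = lin_form w u + lin_form w v"
proof -
  let ?S = "{c. u c \<noteq> 0} \<union> {c. v c \<noteq> 0}"
  have "lin_form w (\<lambda>c. u c + v c) = (\<Sum>c\<in>?S. w c * (u c + v c))"
    and "lin_form w u = (\<Sum>c\<in>?S. w c * u c)" and "lin_form w v = (\<Sum>c\<in>?S. w c * v c)"
    using assms by (auto intro!: lin_form_eq_sum)
  then show ?thesis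
    by (simp add: algebra_simps sum.distrib)
qed

lemma lin_form_scale: "lin_form w (\<lambda>c. a * v c) = a * lin_form w v"
proof (cases "a = 0")
  case False
  then show ?thesis
    by (simp add: lin_form_def sum_distrib_left mult.left_commute)
qed (simp add: lin_form_def)

lemma finite_support_add:
  fixes u v :: "nat \<Rightarrow> 'a::field"
  assumes "finite {c. u c \<noteq> 0}" and "finite {c. v c \<noteq> 0}"
  shows "finite {c. u c + v c \<noteq> 0}"
  by (rule finite_subset[of _ "{c. u c \<noteq> 0} \<union> {c. v c \<noteq> 0}"]) (use assms in auto)

lemma finite_support_scale:
  fixes v :: "nat \<Rightarrow> 'a::field"
  assumes "finite {c. v c \<noteq> 0}"
  shows "finite {c. a * v c \<noteq> 0}"
  by (rule finite_subset[OF _ assms]) auto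

text \<open>Both claims go through one induction, since splitting off a summand in the second needs
  the finite support of the remaining sum from the first.\<close>

lemma lin_form_sum:
  assumes "finite I" and "\<And>x. x \<in> I \<Longrightarrow> finite {c. U x c \<noteq> 0}"
  shows "finite {c. (\<Sum>x\<in>I. a x * U x c) \<noteq> 0}"
    and "lin_form w (\<lambda>c. \<Sum>x\<in>I. a x * U x c) = (\<Sum>x\<in>I. a x * lin_form w (U x))"
  using assms
proof (induction I rule: finite_induct)
  case (insert z I)
  { case 1
    then show ?case
      using insert by (simp add: finite_support_add finite_support_scale) }
  { case 2
    then show ?case
      using insert by (simp add: lin_form_add lin_form_scale finite_support_scale) }
qed (simp_all add: lin_form_def)

text \<open>Induction in the style of Gram-Schmidt: a unit vector at a suitable column is corrected
  to be annihilated by the old rows and scaled to be dual to the new row; then the old dual vectors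
  are corrected to be annihilated by the new row.\<close>

lemma exists_dual_vectors:
  fixes W :: "'x \<Rightarrow> nat \<Rightarrow> 'a::field"
  assumes "finite I"
    and "\<forall>h. (\<forall>c. (\<Sum>x\<in>I. h x * W x c) = 0) \<longrightarrow> (\<forall>x\<in>I. h x = 0)"
  shows "\<exists>U. (\<forall>x\<in>I. finite {c. U x c \<noteq> 0}) \<and>
    (\<forall>x\<in>I. \<forall>y\<in>I. lin_form (W y) (U x) = (if x = y then 1 else 0))"
  using assms
proof (induction I rule: finite_induct)
  case (insert z I)
  have "\<exists>U. (\<forall>x\<in>I. finite {c. U x c \<noteq> 0}) \<and>
    (\<forall>x\<in>I. \<forall>y\<in>I. lin_form (W y) (U x) = (if x = y then 1 else 0))"
  proof (rule insert.IH, intro allI impI ballI)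
    fix h x assume h: "\<forall>c. (\<Sum>x\<in>I. h x * W x c) = 0" and x: "x \<in> I"
    have rel: "(\<Sum>x\<in>insert z I. (if x = z then 0 else h x) * W x c) = 0" for c
    proof -
      have "(\<Sum>x\<in>I. (if x = z then 0 else h x) * W x c) = (\<Sum>x\<in>I. h x * W x c)"
        using insert.hyps by (intro sum.cong) auto
      then show ?thesis
        using insert.hyps h by simp
    qed
    have "\<forall>x\<in>insert z I. (if x = z then 0 else h x) = 0"
      by (intro insert.prems[THEN spec, THEN mp] allI) (rule rel)
    then show "h x = 0"
      using x insert.hyps by (auto split: if_splits)
  qed
  then obtain U where fin: "\<And>x. x \<in> I \<Longrightarrow> finite {c. U x c \<noteq> 0}"
    and dual: "\<And>x y. x \<in> I \<Longrightarrow> y \<in> I \<Longrightarrow> lin_form (W y) (U x) = (if x = y then 1 else 0)"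
    by blast
  \<comment> \<open>The part of row \<open>z\<close> left after subtracting the combination of the
    old rows that agrees with it on the vectors \<open>U x\<close>. If it vanished, row
    \<open>z\<close> would be a combination of the old rows.\<close>
  define R where "R c = W z c - (\<Sum>x\<in>I. W x c * lin_form (W z) (U x))" for c
  obtain c where c: "R c \<noteq> 0"
  proof (rule ccontr)
    assume "\<not> thesis"
    then have R0: "R c = 0" for c
      using that by blast
    have rel: "(\<Sum>x\<in>insert z I. (if x = z then 1 else - lin_form (W z) (U x)) * W x c) = 0" for c
    proof -
      have "(\<Sum>x\<in>I. (if x = z then 1 else - lin_form (W z) (U x)) * W x c) =
        - (\<Sum>x\<in>I. W x c * lin_form (W z) (U x))"
        unfolding sum_negf[symmetric] using insert.hyps by (intro sum.cong) auto
      then show ?thesis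
        using insert.hyps R0[of c] by (simp add: R_def)
    qed
    have "\<forall>x\<in>insert z I. (if x = z then 1 else - lin_form (W z) (U x)) = 0"
      by (intro insert.prems[THEN spec, THEN mp] allI) (rule rel)
    then show False
      by simp
  qed
  define e where "e = (\<lambda>c'. if c' = c then 1 else (0::'a))"
  have e_fin: "finite {c. e c \<noteq> 0}" and e_form: "lin_form w e = w c" for w
    by (auto simp: e_def lin_form_def)
  \<comment> \<open>The correction makes every old row vanish on \<open>V'\<close>, while row
    \<open>z\<close> takes the value \<open>R c\<close> on it, which is why \<open>V\<close> divides
    by \<open>R c\<close>.\<close>
  define V' where "V' = (\<lambda>c'. e c' + (\<Sum>x\<in>I. (- W x c) * U x c'))"
  have V'_fin: "finite {c'. V' c' \<noteq> 0}"
    unfolding V'_def by (intro finite_support_add e_fin lin_form_sum(1) insert.hyps fin)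
  have V'_form: "lin_form w V' = w c - (\<Sum>x\<in>I. W x c * lin_form w (U x))" for w
    unfolding V'_def
    by (subst lin_form_add[OF e_fin lin_form_sum(1)[OF insert.hyps(1) fin]])
      (simp_all only: lin_form_sum(2)[OF insert.hyps(1) fin] e_form, simp add: sum_negf)
  define V where "V = (\<lambda>c'. (1 / R c) * V' c')"
  have V_fin: "finite {c'. V c' \<noteq> 0}"
    unfolding V_def by (intro finite_support_scale V'_fin)
  have Vz: "lin_form (W z) V = 1"
    unfolding V_def lin_form_scale V'_form using c by (simp add: R_def)
  have Vy: "lin_form (W y) V = 0" if y: "y \<in> I" for y
  proof -
    have "(\<Sum>x\<in>I. W x c * lin_form (W y) (U x)) = (\<Sum>x\<in>I. if x = y then W x c else 0)"
      using y by (intro sum.cong) (auto simp: dual)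
    also have "\<dots> = W y c"
      using insert.hyps y by simp
    finally show ?thesis
      unfolding V_def lin_form_scale V'_form by simp
  qed
  \<comment> \<open>Subtracting a multiple of \<open>V\<close> kills the value of row
    \<open>z\<close> and leaves the values of the old rows unchanged, as they vanish on
    \<open>V\<close>.\<close>
  define U' where "U' x = (if x = z then V else (\<lambda>c'. U x c' + (- lin_form (W z) (U x)) * V c'))" for x
  have "finite {c. U' x c \<noteq> 0}" if "x \<in> insert z I" for x
    using that V_fin finite_support_add[OF fin finite_support_scale[OF V_fin], of x]
    by (cases "x = z") (simp_all only: U'_def if_True if_False refl insert_iff simp_thms)
  moreover have "lin_form (W y) (U' x) = (if x = y then 1 else 0)"
    if x: "x \<in> insert z I" and y: "y \<in> insert z I" for x y
  proof (cases "x = z")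
    case True
    then show ?thesis
      using y Vz Vy insert.hyps by (auto simp: U'_def)
  next
    case False
    then have xI: "x \<in> I"
      using x by simp
    have "lin_form (W y) (U' x) =
      lin_form (W y) (U x) + (- lin_form (W z) (U x)) * lin_form (W y) V"
      unfolding U'_def if_not_P[OF False]
      by (subst lin_form_add[OF fin[OF xI] finite_support_scale[OF V_fin]])
        (simp only: lin_form_scale)
    then show ?thesis
      using y Vz Vy dual[OF xI] False by (cases "y = z") auto
  qed
  ultimately show ?case
    by blast
qed simp

text \<open>A combination of the dual vectors solves the system. The bound \<open>M\<close> comes
  from the supports of these finitely many vectors, so it is the same for all right-hand sides
  \<open>e\<close>; this later gives one block length for all digit patterns.\<close>

lemma independent_rows_solvable:
  fixes W :: "'x \<Rightarrow> nat \<Rightarrow> 'a::field"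
  assumes fI: "finite I"
    and ind: "\<forall>h. (\<forall>c. (\<Sum>x\<in>I. h x * W x c) = 0) \<longrightarrow> (\<forall>x\<in>I. h x = 0)"
  shows "\<exists>M. \<forall>e. \<exists>T. (\<forall>c\<ge>M. T c = 0) \<and> (\<forall>x\<in>I. lin_form (W x) T = e x)"
proof -
  obtain U where fin: "\<And>x. x \<in> I \<Longrightarrow> finite {c. U x c \<noteq> 0}"
    and dual: "\<And>x y. x \<in> I \<Longrightarrow> y \<in> I \<Longrightarrow> lin_form (W y) (U x) = (if x = y then 1 else 0)"
    using exists_dual_vectors[of I W, OF fI ind] by blast
  have "finite (\<Union>x\<in>I. {c. U x c \<noteq> 0})"
    using fI fin by blast
  then obtain M where "\<forall>c\<in>(\<Union>x\<in>I. {c. U x c \<noteq> 0}). c < M"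
    unfolding finite_nat_set_iff_bounded ..
  then have M: "c < M" if "x \<in> I" "U x c \<noteq> 0" for x c
    using that by blast
  show ?thesis
  proof (intro exI[of _ M] allI)
    fix e :: "'x \<Rightarrow> 'a"
    define T where "T = (\<lambda>c. \<Sum>x\<in>I. e x * U x c)"
    have "T c = 0" if "c \<ge> M" for c
      unfolding T_def using M[of _ c] that by (intro sum.neutral) (auto simp: not_le[symmetric])
    moreover have "lin_form (W y) T = e y" if "y \<in> I" for y
    proof -
      have "lin_form (W y) T = (\<Sum>x\<in>I. e x * lin_form (W y) (U x))"
        unfolding T_def by (rule lin_form_sum(2)[OF fI fin])
      also have "\<dots> = (\<Sum>x\<in>I. if x = y then e x else 0)"
        using that by (intro sum.cong) (auto simp: dual)
      finally show ?thesis
        using fI that by simp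
    qed
    ultimately show "\<exists>T. (\<forall>c\<ge>M. T c = 0) \<and> (\<forall>x\<in>I. lin_form (W x) T = e x)"
      by blast
  qed
qed

lemma CARD_field_ge_2: "CARD('a::{field,finite}) \<ge> 2"
proof -
  have "card {0, 1::'a} \<le> CARD('a)"
    by (rule card_mono) auto
  then show ?thesis
    by simp
qed

section \<open>Digits\<close>

locale digit_bijection =
  fixes \<phi> :: "nat \<Rightarrow> 'a::{field,finite}"
  assumes bij: "bij_betw \<phi> {..<CARD('a)} UNIV" and zero: "\<phi> 0 = 0"
begin

abbreviation "\<psi> \<equiv> inv_into {..<CARD('a)} \<phi>"

lemma psi_phi: "r < CARD('a) \<Longrightarrow> \<psi> (\<phi> r) = r"
  using bij by (simp add: bij_betw_def)

lemma psi_less: "\<psi> y < CARD('a)"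
proof -
  have "y \<in> \<phi> ` {..<CARD('a)}"
    using bij by (simp add: bij_betw_def)
  from inv_into_into[OF this] show ?thesis
    by simp
qed

lemma digit_vec_eq_0: "k < CARD('a) ^ M \<Longrightarrow> c \<ge> M \<Longrightarrow> digit_vec \<phi> k c = 0"
proof -
  assume "k < CARD('a) ^ M" and "c \<ge> M"
  moreover have "CARD('a) ^ M \<le> CARD('a) ^ c"
    using \<open>c \<ge> M\<close> CARD_field_ge_2[where 'a = 'a] by (intro power_increasing) auto
  ultimately show ?thesis
    by (simp add: digit_vec_def zero)
qed

lemma less_CARD_power: "k < CARD('a) ^ k"
  using CARD_field_ge_2[where 'a = 'a] by (intro power_gt_expt) simp

lemma finite_support_digit_vec: "finite {c. digit_vec \<phi> k c \<noteq> 0}"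
  by (rule finite_subset[of _ "{..<k}"])
    (use digit_vec_eq_0[OF less_CARD_power] in \<open>auto simp: not_le[symmetric]\<close>)

lemma digit_expansion: "(\<Sum>c<M. \<psi> (digit_vec \<phi> k c) * CARD('a) ^ c) = k mod CARD('a) ^ M"
proof (induction M)
  case (Suc M)
  have "\<psi> (digit_vec \<phi> k M) = k div CARD('a) ^ M mod CARD('a)"
    unfolding digit_vec_def by (rule psi_phi) simp
  then show ?case
    using Suc mod_mult2_eq[of k "CARD('a) ^ M" "CARD('a)"] by (simp add: mult.commute add.commute)
qed simp

lemma digit_vec_inject:
  assumes "digit_vec \<phi> k = digit_vec \<phi> k'"
  shows "k = k'"
proof -
  let ?M = "max k k'"
  have less: "k < CARD('a) ^ ?M" "k' < CARD('a) ^ ?M"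
    using less_CARD_power[of ?M] by simp_all
  have "k mod CARD('a) ^ ?M = k' mod CARD('a) ^ ?M"
    unfolding digit_expansion[symmetric] by (simp add: assms)
  then show ?thesis
    using less by simp
qed

text \<open>By counting: the digit map is injective on the indices below \<open>q^M\<close>, and
  there are just as many functions from \<open>M\<close> positions to the field, so it is
  onto.\<close>

lemma exists_digit_vec:
  assumes "\<And>c. c \<ge> M \<Longrightarrow> v c = 0"
  obtains k where "k < CARD('a) ^ M" and "digit_vec \<phi> k = v"
proof -
  let ?f = "\<lambda>k. restrict (digit_vec \<phi> k) {..<M}"
  have "inj_on ?f {..<CARD('a) ^ M}"
  proof (rule inj_onI)
    fix k k' assume k: "k \<in> {..<CARD('a) ^ M}" "k' \<in> {..<CARD('a) ^ M}" and eq: "?f k = ?f k'"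
    have "digit_vec \<phi> k c = digit_vec \<phi> k' c" if "c < M" for c
      using fun_cong[OF eq, of c] that by simp
    then have "k mod CARD('a) ^ M = k' mod CARD('a) ^ M"
      unfolding digit_expansion[symmetric] by simp
    then show "k = k'"
      using k by simp
  qed
  then have "card (?f ` {..<CARD('a) ^ M}) = card ({..<M} \<rightarrow>\<^sub>E (UNIV :: 'a set))"
    by (simp add: card_image card_PiE)
  moreover have "?f ` {..<CARD('a) ^ M} \<subseteq> {..<M} \<rightarrow>\<^sub>E UNIV"
    by (auto simp: PiE_def)
  ultimately have "?f ` {..<CARD('a) ^ M} = {..<M} \<rightarrow>\<^sub>E UNIV"
    by (intro card_subset_eq finite_PiE) auto
  then have "restrict v {..<M} \<in> ?f ` {..<CARD('a) ^ M}"
    by simp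
  then obtain k where eq: "restrict v {..<M} = ?f k" and "k \<in> {..<CARD('a) ^ M}"
    by (rule imageE)
  then have k: "k < CARD('a) ^ M"
    by simp
  have "digit_vec \<phi> k c = v c" for c
    using fun_cong[OF eq, of c] digit_vec_eq_0[OF k] assms by (cases "c < M") auto
  then show ?thesis
    using that k by blast
qed

lemma digit_vec_div: "digit_vec \<phi> (k div CARD('a) ^ M) c = digit_vec \<phi> k (M + c)"
  by (simp add: digit_vec_def power_add div_mult2_eq)

text \<open>The first entry is the most significant digit, so this numbers the elementary intervals
  of length \<open>1 / q^l\<close> from left to right.\<close>

definition prefix_num :: "nat \<Rightarrow> (nat \<Rightarrow> 'a) \<Rightarrow> nat" where
  "prefix_num l y = (\<Sum>j<l. \<psi> (y j) * CARD('a) ^ (l - Suc j))"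

lemma prefix_num_digit_vec:
  assumes "d < CARD('a) ^ l" and "\<And>j. j < l \<Longrightarrow> y j = digit_vec \<phi> d (l - Suc j)"
  shows "prefix_num l y = d"
proof -
  have "prefix_num l y = (\<Sum>j<l. \<psi> (digit_vec \<phi> d (l - Suc j)) * CARD('a) ^ (l - Suc j))"
    unfolding prefix_num_def by (intro sum.cong) (auto simp: assms(2))
  also have "\<dots> = (\<Sum>c<l. \<psi> (digit_vec \<phi> d c) * CARD('a) ^ c)"
    by (rule sum.nat_diff_reindex)
  finally show ?thesis
    using assms(1) by (simp add: digit_expansion)
qed

text \<open>The first \<open>l\<close> entries in reverse order are the base \<open>q\<close> digits
  of some \<open>d < q^l\<close>, and this \<open>d\<close> must be the prefix number.\<close>

lemma prefix_num_digits:
  shows prefix_num_less: "prefix_num l y < CARD('a) ^ l"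
    and digit_vec_prefix_num: "j < l \<Longrightarrow> digit_vec \<phi> (prefix_num l y) (l - Suc j) = y j"
proof -
  obtain d where d: "d < CARD('a) ^ l"
    and eq: "digit_vec \<phi> d = (\<lambda>c. if c < l then y (l - Suc c) else 0)"
    using exists_digit_vec[of l "\<lambda>c. if c < l then y (l - Suc c) else 0"] by auto
  have y: "y j = digit_vec \<phi> d (l - Suc j)" if "j < l" for j
    using that by (simp add: eq)
  have "prefix_num l y = d"
    using d y by (rule prefix_num_digit_vec)
  then show "prefix_num l y < CARD('a) ^ l"
    and "j < l \<Longrightarrow> digit_vec \<phi> (prefix_num l y) (l - Suc j) = y j"
    using d y by simp_all
qed

lemma prefix_num_eq_iff:
  assumes "d < CARD('a) ^ l"
  shows "prefix_num l y = d \<longleftrightarrow> (\<forall>j<l. y j = digit_vec \<phi> d (l - Suc j))"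
  using prefix_num_digit_vec[OF assms, of y] digit_vec_prefix_num[of _ l y] by auto

lemma mat_digit_eq_lin_form: "mat_digit \<phi> A k j = lin_form (A j) (digit_vec \<phi> k)"
  by (simp add: mat_digit_def lin_form_def)

end

section \<open>Equidistribution of digit prefixes\<close>

lemma div_eq_atLeastLessThan:
  fixes L :: nat
  assumes "L > 0"
  shows "{k. k div L = n} = {n * L..<n * L + L}"
proof -
  have "k div L = n \<longleftrightarrow> n * L \<le> k \<and> k < n * L + L" for k
    using assms dividend_less_div_times[OF assms, of k] by (auto simp: div_nat_eqI mult.commute add.commute)
  then show ?thesis
    by (simp add: set_eq_iff)
qed

lemma card_periodic_blocks:
  fixes L c :: nat
  assumes L: "L > 0" and c: "\<And>n. card {k. k div L = n \<and> P k} = c"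
  shows "card {k. k div L < n \<and> P k} = n * c"
proof (induction n)
  case (Suc n)
  have fin: "finite {k. k div L = n \<and> P k}" for n
  proof (rule finite_subset)
    show "{k. k div L = n \<and> P k} \<subseteq> {k. k div L = n}"
      by auto
  qed (simp add: div_eq_atLeastLessThan[OF L])
  have *: "{k. k div L < Suc n \<and> P k} = {k. k div L < n \<and> P k} \<union> {k. k div L = n \<and> P k}"
    by auto
  have "finite {k. k div L < n \<and> P k}"
    by (rule finite_subset[of _ "{..<n * L}"]) (auto simp: div_less_iff_less_mult[OF L])
  then have "card {k. k div L < Suc n \<and> P k} = card {k. k div L < n \<and> P k} + card {k. k div L = n \<and> P k}"
    unfolding * by (intro card_Un_disjoint fin) auto
  then show ?case
    using Suc c by simp
qed simp

text \<open>The count up to \<open>N\<close> lies between the counts over the complete blocks below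
  \<open>N\<close> and over one block more, so it differs from \<open>c / L * N\<close> by at most
  \<open>c\<close>; dividing by \<open>N\<close> removes the error.\<close>

lemma periodic_density:
  fixes L c :: nat
  assumes L: "L > 0" and c: "\<And>n. card {k. k div L = n \<and> P k} = c"
  shows "(\<lambda>N. real (card {k. k < N \<and> P k}) / real N) \<longlonglongrightarrow> real c / real L"
proof -
  have bound: "\<bar>real (card {k. k < N \<and> P k}) - real c / real L * real N\<bar> \<le> real c" for N
  proof -
    define n where "n = N div L"
    have "{k. k div L < n \<and> P k} \<subseteq> {k. k < N \<and> P k}"
      unfolding n_def using div_le_mono[of N _ L] by (auto simp: not_less[symmetric])
    then have lo: "n * c \<le> card {k. k < N \<and> P k}"
      using card_mono[of "{k. k < N \<and> P k}" "{k. k div L < n \<and> P k}"] card_periodic_blocks[OF L c]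
      by simp
    have fin: "finite {k. k div L < Suc n \<and> P k}"
      by (rule finite_subset[of _ "{..<Suc n * L}"]) (auto simp del: mult_Suc simp: div_less_iff_less_mult[OF L])
    have "{k. k < N \<and> P k} \<subseteq> {k. k div L < Suc n \<and> P k}"
      unfolding n_def using div_le_mono[of _ N L] by (auto simp: less_Suc_eq_le)
    then have hi: "card {k. k < N \<and> P k} \<le> Suc n * c"
      using card_mono[OF fin, of "{k. k < N \<and> P k}"] card_periodic_blocks[OF L c, of "Suc n"] by simp
    have "n * L \<le> N" "N \<le> Suc n * L"
      using dividend_less_div_times[OF L, of N] by (auto simp: n_def)
    then have "real n * real L \<le> real N" "real N \<le> (real n + 1) * real L"
      by (metis of_nat_le_iff of_nat_mult, metis of_nat_le_iff of_nat_mult of_nat_Suc add.commute)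
    then have "real n \<le> real N / real L" "real N / real L \<le> real n + 1"
      using L by (simp_all add: field_simps)
    then have "real n * real c \<le> real N / real L * real c" "real N / real L * real c \<le> (real n + 1) * real c"
      by (intro mult_right_mono; simp)+
    moreover have "real n * real c \<le> card {k. k < N \<and> P k}" "card {k. k < N \<and> P k} \<le> (real n + 1) * real c"
      using lo hi by (metis of_nat_le_iff of_nat_mult, metis of_nat_le_iff of_nat_mult of_nat_Suc add.commute)
    ultimately show ?thesis
      by (simp add: abs_le_iff algebra_simps)
  qed
  have "(\<lambda>N. real (card {k. k < N \<and> P k}) / real N - real c / real L) \<longlonglongrightarrow> 0"
  proof (rule tendsto_0_le[where K = 1])
    show "\<forall>\<^sub>F N in sequentially.
      norm (real (card {k. k < N \<and> P k}) / real N - real c / real L) \<le>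
        norm (real c / real N) * 1"
      using eventually_gt_at_top[of 0]
    proof eventually_elim
      case (elim N)
      then have "real (card {k. k < N \<and> P k}) / real N - real c / real L =
        (real (card {k. k < N \<and> P k}) - real c / real L * real N) / real N"
        by (simp add: diff_divide_distrib)
      then show ?case
        using bound[of N] elim by (simp add: abs_divide divide_right_mono)
    qed
    show "(\<lambda>N. real c / real N) \<longlonglongrightarrow> 0"
      by (rule lim_const_over_n)
  qed
  then show ?thesis
    by (rule LIM_zero_cancel)
qed

section \<open>Equal frequency of all digit patterns in each block\<close>

context digit_bijection
begin

abbreviation prefix :: "(nat \<Rightarrow> nat \<Rightarrow> nat \<Rightarrow> 'a) \<Rightarrow> nat \<Rightarrow> nat \<Rightarrow> nat \<Rightarrow> nat" where
  "prefix C l k i \<equiv> prefix_num l (mat_digit \<phi> (C i) k)"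

text \<open>Adding \<open>T\<close> to the digit vector is an injection from the indices with
  pattern \<open>d\<close> to those with pattern \<open>d'\<close> within the same block. Exchanging
  \<open>d\<close> and \<open>d'\<close> later turns the inequality into an equality.\<close>

lemma prefix_block_card_le:
  assumes T: "\<forall>c\<ge>M. T c = 0"
    and T_form: "\<And>i j. i < s \<Longrightarrow> j < l \<Longrightarrow> lin_form (C i j) T =
      digit_vec \<phi> (d' i) (l - Suc j) - digit_vec \<phi> (d i) (l - Suc j)"
    and d: "\<And>i. i < s \<Longrightarrow> d i < CARD('a) ^ l" and d': "\<And>i. i < s \<Longrightarrow> d' i < CARD('a) ^ l"
  shows "card {k. k div CARD('a) ^ M = n \<and> (\<forall>i<s. prefix C l k i = d i)} \<le>
    card {k. k div CARD('a) ^ M = n \<and> (\<forall>i<s. prefix C l k i = d' i)}"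
    (is "card ?A \<le> card ?B")
proof -
  have fin_T: "finite {c. T c \<noteq> 0}"
    by (rule finite_subset[of _ "{..<M}"]) (use T in \<open>auto simp: not_le[symmetric]\<close>)
  \<comment> \<open>The addition is digitwise in the field, without carries. The sum still has
    finite support, so it is the digit vector of an index.\<close>
  have "\<exists>k'. digit_vec \<phi> k' = (\<lambda>c. digit_vec \<phi> k c + T c)" for k
  proof -
    have "digit_vec \<phi> k c + T c = 0" if "c \<ge> max k M" for c
      using that T digit_vec_eq_0[OF less_CARD_power, of k c] by simp
    then obtain k' where "digit_vec \<phi> k' = (\<lambda>c. digit_vec \<phi> k c + T c)"
      using exists_digit_vec[of "max k M" "\<lambda>c. digit_vec \<phi> k c + T c"] by metis
    then show ?thesis ..
  qed
  then obtain \<tau> where \<tau>: "\<And>k. digit_vec \<phi> (\<tau> k) = (\<lambda>c. digit_vec \<phi> k c + T c)"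
    by metis
  have "inj_on \<tau> ?A"
  proof (rule inj_onI)
    fix k k' assume "\<tau> k = \<tau> k'"
    then have "digit_vec \<phi> k c + T c = digit_vec \<phi> k' c + T c" for c
      using \<tau>[of k] \<tau>[of k'] by metis
    then show "k = k'"
      by (intro digit_vec_inject) auto
  qed
  moreover have "\<tau> ` ?A \<subseteq> ?B"
  proof (rule image_subsetI)
    fix k assume k: "k \<in> ?A"
    \<comment> \<open>\<open>T\<close> vanishes from position \<open>M\<close> on, so the higher
      digits, and with them the block, stay the same.\<close>
    have "digit_vec \<phi> (\<tau> k div CARD('a) ^ M) = digit_vec \<phi> (k div CARD('a) ^ M)"
      using T by (intro ext) (simp add: digit_vec_div \<tau>)
    then have "\<tau> k div CARD('a) ^ M = n"
      using digit_vec_inject k by auto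
    moreover have "prefix C l (\<tau> k) i = d' i" if i: "i < s" for i
      unfolding prefix_num_eq_iff[OF d'[OF i]]
    proof (intro allI impI)
      fix j assume j: "j < l"
      have "mat_digit \<phi> (C i) k j = digit_vec \<phi> (d i) (l - Suc j)"
        using k i j prefix_num_eq_iff[OF d[OF i], of "mat_digit \<phi> (C i) k"] by blast
      then show "mat_digit \<phi> (C i) (\<tau> k) j = digit_vec \<phi> (d' i) (l - Suc j)"
        by (simp add: mat_digit_eq_lin_form \<tau> lin_form_add[OF finite_support_digit_vec fin_T]
            T_form[OF i j])
    qed
    ultimately show "\<tau> k \<in> ?B"
      by simp
  qed
  moreover have "finite ?B"
  proof (rule finite_subset)
    show "?B \<subseteq> {k. k div CARD('a) ^ M = n}"
      by auto
  qed (simp add: div_eq_atLeastLessThan)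
  ultimately show ?thesis
    by (rule card_inj_on_le)
qed

text \<open>All \<open>(q^l)^s\<close> patterns occur equally often in a block of \<open>q^M\<close>
  indices. The count is stated in multiplied form to stay within the natural numbers, and
  \<open>M\<close> depends neither on the block \<open>n\<close> nor on the sets
  \<open>D\<close>.\<close>

lemma prefix_block_card:
  assumes ind: "\<forall>h. (\<forall>c. (\<Sum>i<s. \<Sum>j<l. h i j * C i j c) = 0) \<longrightarrow> (\<forall>i<s. \<forall>j<l. h i j = 0)"
  obtains M where "\<And>n D. (\<And>i. i < s \<Longrightarrow> D i \<subseteq> {..<CARD('a) ^ l}) \<Longrightarrow>
    card {k. k div CARD('a) ^ M = n \<and> (\<forall>i<s. prefix C l k i \<in> D i)} * (CARD('a) ^ l) ^ s =
    (\<Prod>i<s. card (D i)) * CARD('a) ^ M"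
proof -
  have "\<forall>h. (\<forall>c. (\<Sum>x\<in>{..<s} \<times> {..<l}. h x * case_prod C x c) = 0) \<longrightarrow>
    (\<forall>x\<in>{..<s} \<times> {..<l}. h x = 0)"
  proof (intro allI impI ballI)
    fix h x assume rel: "\<forall>c. (\<Sum>x\<in>{..<s} \<times> {..<l}. h x * case_prod C x c) = 0" and x: "x \<in> {..<s} \<times> {..<l}"
    have "\<forall>c. (\<Sum>i<s. \<Sum>j<l. h (i, j) * C i j c) = 0"
      using rel by (simp add: sum.cartesian_product case_prod_unfold)
    from ind[THEN spec, THEN mp, of "\<lambda>i j. h (i, j)", OF this]
    have "\<forall>i<s. \<forall>j<l. h (i, j) = 0" .
    then show "h x = 0"
      using x by blast
  qed
  then have "\<exists>M. \<forall>e. \<exists>T. (\<forall>c\<ge>M. T c = 0) \<and>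
      (\<forall>x\<in>{..<s} \<times> {..<l}. lin_form (case_prod C x) T = e x)"
    by (intro independent_rows_solvable) simp_all
  then obtain M where M: "\<forall>e. \<exists>T. (\<forall>c\<ge>M. T c = 0) \<and>
      (\<forall>x\<in>{..<s} \<times> {..<l}. lin_form (case_prod C x) T = e x)" ..
  define X where "X = {..<s} \<rightarrow>\<^sub>E {..<CARD('a) ^ l}"
  have fin_X: "finite X" and card_X: "card X = (CARD('a) ^ l) ^ s"
    unfolding X_def by (auto intro: finite_PiE simp: card_PiE)
  show ?thesis
  proof (rule that[of M])
    fix n D assume D: "\<And>i. i < s \<Longrightarrow> D i \<subseteq> {..<CARD('a) ^ l}"
    define B where "B = {k. k div CARD('a) ^ M = n}"
    have B: "finite B" "card B = CARD('a) ^ M"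
      by (simp_all add: B_def div_eq_atLeastLessThan)
    define g where "g k = restrict (prefix C l k) {..<s}" for k
    have g: "g k \<in> X" for k
      using prefix_num_less by (auto simp: g_def X_def)
    have fibre: "{k \<in> B. g k = d} = {k. k div CARD('a) ^ M = n \<and> (\<forall>i<s. prefix C l k i = d i)}"
      if "d \<in> X" for d
      using that by (auto simp: B_def g_def X_def fun_eq_iff PiE_def extensional_def)
    \<comment> \<open>The system is solved for the digit differences between the two
      patterns.\<close>
    have le: "card {k \<in> B. g k = d} \<le> card {k \<in> B. g k = d'}" if d: "d \<in> X" and d': "d' \<in> X" for d d'
    proof -
      obtain T where T: "\<forall>c\<ge>M. T c = 0"
        and T_form: "\<forall>x\<in>{..<s} \<times> {..<l}. lin_form (case_prod C x) T =
          (\<lambda>(i, j). digit_vec \<phi> (d' i) (l - Suc j) - digit_vec \<phi> (d i) (l - Suc j)) x"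
        using M[THEN spec, of "\<lambda>(i, j). digit_vec \<phi> (d' i) (l - Suc j) - digit_vec \<phi> (d i) (l - Suc j)"]
        by blast
      show ?thesis
        unfolding fibre[OF d] fibre[OF d']
        by (rule prefix_block_card_le[OF T]) (use T_form d d' in \<open>auto simp: X_def\<close>)
    qed
    obtain d\<^sub>0 where d\<^sub>0: "d\<^sub>0 \<in> X"
      using g by blast
    define c where "c = card {k \<in> B. g k = d\<^sub>0}"
    have c: "card {k \<in> B. g k = d} = c" if "d \<in> X" for d
      unfolding c_def using le[OF that d\<^sub>0] le[OF d\<^sub>0 that] by simp
    have count: "card {k \<in> B. g k \<in> E} = card E * c" if E: "E \<subseteq> X" for E
    proof -
      have "finite E"
        using E fin_X finite_subset by blast
      then have "(\<Sum>d\<in>E. \<Sum>k\<in>{k \<in> {k \<in> B. g k \<in> E}. g k = d}. 1) = (\<Sum>k\<in>{k \<in> B. g k \<in> E}. 1::nat)"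
        using B by (intro sum.group) auto
      then have "card {k \<in> B. g k \<in> E} = (\<Sum>d\<in>E. card {k \<in> {k \<in> B. g k \<in> E}. g k = d})"
        by simp
      also have "\<dots> = (\<Sum>d\<in>E. c)"
      proof (rule sum.cong[OF refl])
        fix d assume "d \<in> E"
        moreover from this have "{k \<in> {k \<in> B. g k \<in> E}. g k = d} = {k \<in> B. g k = d}"
          by auto
        ultimately show "card {k \<in> {k \<in> B. g k \<in> E}. g k = d} = c"
          using E c by auto
      qed
      finally show ?thesis
        by simp
    qed
    \<comment> \<open>Taking all patterns at once counts the whole block and so determines the
      common frequency \<open>c\<close>.\<close>
    have total: "CARD('a) ^ M = (CARD('a) ^ l) ^ s * c"
      using count[of X] g B card_X by simp
    have "{k. k div CARD('a) ^ M = n \<and> (\<forall>i<s. prefix C l k i \<in> D i)} = {k \<in> B. g k \<in> PiE {..<s} D}"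
      by (auto simp: B_def g_def PiE_iff)
    also have "card \<dots> = card (PiE {..<s} D) * c"
      by (rule count) (use D in \<open>auto simp: X_def PiE_iff\<close>)
    also have "card (PiE {..<s} D) = (\<Prod>i<s. card (D i))"
      by (simp add: card_PiE)
    finally show "card {k. k div CARD('a) ^ M = n \<and> (\<forall>i<s. prefix C l k i \<in> D i)} * (CARD('a) ^ l) ^ s =
      (\<Prod>i<s. card (D i)) * CARD('a) ^ M"
      by (simp add: total)
  qed
qed

lemma prefix_density:
  assumes ind: "\<forall>h. (\<forall>c. (\<Sum>i<s. \<Sum>j<l. h i j * C i j c) = 0) \<longrightarrow> (\<forall>i<s. \<forall>j<l. h i j = 0)"
    and D: "\<And>i. i < s \<Longrightarrow> D i \<subseteq> {..<CARD('a) ^ l}"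
  shows "(\<lambda>N. real (card {k. k < N \<and> (\<forall>i<s. prefix C l k i \<in> D i)}) / real N)
    \<longlonglongrightarrow> (\<Prod>i<s. real (card (D i)) / real (CARD('a) ^ l))"
proof -
  obtain M where M: "\<And>n. card {k. k div CARD('a) ^ M = n \<and> (\<forall>i<s. prefix C l k i \<in> D i)} * (CARD('a) ^ l) ^ s =
    (\<Prod>i<s. card (D i)) * CARD('a) ^ M"
    using prefix_block_card[OF ind, of thesis] D by blast
  \<comment> \<open>Block 0 serves as reference: the product formula has the same right-hand side
    for every block.\<close>
  define c where "c = card {k. k div CARD('a) ^ M = 0 \<and> (\<forall>i<s. prefix C l k i \<in> D i)}"
  have "card {k. k div CARD('a) ^ M = n \<and> (\<forall>i<s. prefix C l k i \<in> D i)} = c" for n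
  proof -
    have "card {k. k div CARD('a) ^ M = n \<and> (\<forall>i<s. prefix C l k i \<in> D i)} * (CARD('a) ^ l) ^ s =
      c * (CARD('a) ^ l) ^ s"
      unfolding c_def M ..
    then show ?thesis
      by simp
  qed
  then have "(\<lambda>N. real (card {k. k < N \<and> (\<forall>i<s. prefix C l k i \<in> D i)}) / real N)
    \<longlonglongrightarrow> real c / real (CARD('a) ^ M)"
    by (intro periodic_density) simp_all
  also have "real c / real (CARD('a) ^ M) = (\<Prod>i<s. real (card (D i)) / real (CARD('a) ^ l))"
  proof -
    have "real (c * (CARD('a) ^ l) ^ s) = real ((\<Prod>i<s. card (D i)) * CARD('a) ^ M)"
      unfolding c_def M ..
    then show ?thesis
      by (simp add: prod_dividef field_simps)
  qed
  finally show ?thesis .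
qed

end

section \<open>From prefixes to boxes\<close>

text \<open>Multiplication by \<open>q^l\<close> splits the series into the integer \<open>d\<close>
  and a tail between 0 and 1. The tail equals 1 when all later digits are \<open>q - 1\<close>, so
  the upper bound cannot be strict.\<close>

lemma digit_series_bounds:
  fixes q l :: nat and a :: "nat \<Rightarrow> nat"
  assumes q: "q \<ge> 2" and a: "\<And>j. a j < q"
  defines "x \<equiv> (\<Sum>j. real (a j) / real q ^ Suc j)"
    and "d \<equiv> (\<Sum>j<l. a j * q ^ (l - Suc j))"
  shows "real d \<le> x * real (q ^ l)" and "x * real (q ^ l) \<le> real d + 1"
proof -
  have q0: "real q > 0"
    using q by simp
  \<comment> \<open>The largest possible series, with all digits equal to \<open>q - 1\<close>; it
    dominates the given series and its shifted tail.\<close>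
  have geo: "(\<lambda>n. (real q - 1) / real q ^ Suc n) sums 1"
  proof -
    have "(\<lambda>n. (1 / real q) ^ n) sums (1 / (1 - 1 / real q))"
      using q by (intro geometric_sums) simp
    then have "(\<lambda>n. (real q - 1) / real q * (1 / real q) ^ n) sums
        ((real q - 1) / real q * (1 / (1 - 1 / real q)))"
      by (rule sums_mult)
    moreover have "(real q - 1) / real q * (1 / (1 - 1 / real q)) = 1"
      using q by (simp add: field_simps)
    ultimately show ?thesis
      by (simp only:) (simp add: power_divide)
  qed
  have le: "real (a j) / real q ^ Suc n \<le> (real q - 1) / real q ^ Suc n" for j n
    using a[of j] q0 by (intro divide_right_mono) auto
  have summ: "summable (\<lambda>j. real (a j) / real q ^ Suc j)"
  proof (rule summable_comparison_test'[of "\<lambda>n. (real q - 1) / real q ^ Suc n" 0])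
    show "summable (\<lambda>n. (real q - 1) / real q ^ Suc n)"
      using geo by (rule sums_summable)
    show "norm (real (a n) / real q ^ Suc n) \<le> (real q - 1) / real q ^ Suc n" for n
      using le[of n n] by simp
  qed
  have summ': "summable (\<lambda>n. real (a (n + l)) / real q ^ Suc n)"
  proof (rule summable_comparison_test'[of "\<lambda>n. (real q - 1) / real q ^ Suc n" 0])
    show "summable (\<lambda>n. (real q - 1) / real q ^ Suc n)"
      using geo by (rule sums_summable)
    show "norm (real (a (n + l)) / real q ^ Suc n) \<le> (real q - 1) / real q ^ Suc n" for n
      using le[of "n + l" n] by simp
  qed
  define t where "t = (\<Sum>n. real (a (n + l)) / real q ^ Suc n)"
  have "t \<ge> 0"
    unfolding t_def using summ' by (intro suminf_nonneg) simp_all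
  moreover have "t \<le> 1"
  proof -
    have "t \<le> (\<Sum>n. (real q - 1) / real q ^ Suc n)"
      unfolding t_def by (rule suminf_le[OF le summ' sums_summable[OF geo]])
    also have "\<dots> = 1"
      using geo by (rule sums_unique[symmetric])
    finally show ?thesis .
  qed
  moreover have "x * real (q ^ l) = real d + t"
  proof -
    have "x = (\<Sum>n. real (a (n + l)) / real q ^ Suc (n + l)) + (\<Sum>j<l. real (a j) / real q ^ Suc j)"
      unfolding x_def by (rule suminf_split_initial_segment[OF summ])
    moreover have "(\<Sum>n. real (a (n + l)) / real q ^ Suc (n + l)) * real q ^ l = t"
    proof -
      have "(\<Sum>n. real (a (n + l)) / real q ^ Suc (n + l)) =
        (\<Sum>n. real (a (n + l)) / real q ^ Suc n * (1 / real q ^ l))"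
        by (simp add: power_add mult.assoc)
      also have "\<dots> = t * (1 / real q ^ l)"
        unfolding t_def by (rule suminf_mult2[OF summ', symmetric])
      finally show ?thesis
        using q0 by simp
    qed
    moreover have "(\<Sum>j<l. real (a j) / real q ^ Suc j) * real q ^ l = real d"
      unfolding d_def sum_distrib_right of_nat_sum
    proof (rule sum.cong[OF refl])
      fix j assume "j \<in> {..<l}"
      then have "real q ^ l = real q ^ Suc j * real q ^ (l - Suc j)"
        unfolding power_add[symmetric] by simp
      then show "real (a j) / real q ^ Suc j * real q ^ l = real (a j * q ^ (l - Suc j))"
        using q0 by simp
    qed
    ultimately show ?thesis
      by (simp add: distrib_right)
  qed
  ultimately show "real d \<le> x * real (q ^ l)" and "x * real (q ^ l) \<le> real d + 1"
    by linarith+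
qed

text \<open>The properties of the leading digits that the passage to boxes relies on: at each level
  \<open>l\<close>, the point lies in the closed elementary interval with number
  \<open>D l k i\<close>.\<close>

locale prefix_sequence =
  fixes s q :: nat and X :: "nat \<Rightarrow> nat \<Rightarrow> real" and D :: "nat \<Rightarrow> nat \<Rightarrow> nat \<Rightarrow> nat"
  assumes q: "q \<ge> 2"
    and less: "i < s \<Longrightarrow> D l k i < q ^ l"
    and lower: "i < s \<Longrightarrow> real (D l k i) \<le> X k i * real (q ^ l)"
    and upper: "i < s \<Longrightarrow> X k i * real (q ^ l) \<le> real (D l k i) + 1"
begin

text \<open>At level \<open>l = 0\<close> there is a single interval, so \<open>D\<close> is 0 and
  the bounds become those of the unit interval.\<close>

lemma unit_interval: "i < s \<Longrightarrow> 0 \<le> X k i" "i < s \<Longrightarrow> X k i \<le> 1"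
  using less[of i 0 k] lower[of i 0 k] upper[of i k 0] by simp_all

lemma frac_cases:
  assumes "i < s"
  shows "X k i < 1 \<and> frac (X k i) = X k i \<or> X k i = 1 \<and> frac (X k i) = 0"
  using unit_interval[OF assms, of k] by (cases "X k i = 1") (auto simp: frac_eq)

text \<open>A box inside the missed elementary box contains no point, although its volume is
  positive, so the frequencies cannot converge to that volume.\<close>

lemma not_uniformly_distributed:
  assumes d: "\<And>i. i < s \<Longrightarrow> d i < q ^ l" and missing: "\<And>k. \<exists>i<s. D l k i \<noteq> d i"
  shows "\<not> uniformly_distributed_mod1 s X"
proof
  assume ud: "uniformly_distributed_mod1 s X"
  define Q where "Q = real (q ^ l)"
  have Q: "Q > 0"
    using q by (simp add: Q_def)
  define a where "a i = (real (d i) + 1/3) / Q" for i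
  define b where "b i = (real (d i) + 2/3) / Q" for i
  have ab: "0 < a i \<and> a i < b i \<and> b i \<le> 1" if "i < s" for i
  proof -
    have "real (d i) + 1 \<le> Q"
      using d[OF that] unfolding Q_def by (metis Suc_leI of_nat_Suc of_nat_le_iff add.commute)
    then show ?thesis
      using Q by (simp add: a_def b_def field_simps)
  qed
  have empty: "{k. k < N \<and> (\<forall>i<s. frac (X k i) \<in> {a i..<b i})} = {}" for N
  proof -
    have False if *: "\<forall>i<s. frac (X k i) \<in> {a i..<b i}" for k
    proof -
      obtain i where i: "i < s" and ne: "D l k i \<noteq> d i"
        using missing by blast
      have "a i \<le> frac (X k i)" "frac (X k i) < b i"
        using * i by auto
      then have "a i \<le> X k i" "X k i < b i"
        using frac_cases[OF i, of k] ab[OF i] by auto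
      then have "real (d i) + 1/3 \<le> X k i * Q" "X k i * Q < real (d i) + 2/3"
        using Q by (simp_all add: a_def b_def field_simps)
      then have "real (d i) < real (D l k i) + 1" "real (D l k i) < real (d i) + 1"
        using lower[OF i, of l k] upper[OF i, of k l] unfolding Q_def by linarith+
      then show False
        using ne by linarith
    qed
    then show ?thesis
      by blast
  qed
  have "(\<lambda>N. real (card {k. k < N \<and> (\<forall>i<s. frac (X k i) \<in> {a i..<b i})}) / real N)
      \<longlonglongrightarrow> (\<Prod>i<s. b i - a i)"
    using ud ab unfolding uniformly_distributed_mod1_def by (meson less_imp_le)
  then have "(\<lambda>N::nat. 0::real) \<longlonglongrightarrow> (\<Prod>i<s. b i - a i)"
    unfolding empty by simp
  then have "(\<Prod>i<s. b i - a i) = 0"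
    by (simp add: LIMSEQ_const_iff)
  moreover have "(\<Prod>i<s. b i - a i) > 0"
    using ab by (intro prod_pos) simp
  ultimately show False
    by linarith
qed

lemma tendsto_div_power_of_bounded_diff:
  fixes c e :: real and f :: "nat \<Rightarrow> real"
  assumes "\<And>l. \<bar>f l - c * real (q ^ l)\<bar> \<le> e"
  shows "(\<lambda>l. f l / real (q ^ l)) \<longlonglongrightarrow> c"
proof -
  have "(\<lambda>l. f l / real (q ^ l) - c) \<longlonglongrightarrow> 0"
  proof (rule tendsto_0_le[where K = 1])
    have "(\<lambda>l. e * (1 / real q) ^ l) \<longlonglongrightarrow> e * 0"
      using q by (intro tendsto_mult tendsto_const LIMSEQ_realpow_zero) auto
    then show "(\<lambda>l. e / real (q ^ l)) \<longlonglongrightarrow> 0"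
      by (simp add: power_divide)
    show "\<forall>\<^sub>F l in sequentially. norm (f l / real (q ^ l) - c) \<le> norm (e / real (q ^ l)) * 1"
    proof (rule always_eventually, rule allI)
      fix l
      have pos: "real (q ^ l) > 0"
        using q by simp
      then have "f l / real (q ^ l) - c = (f l - c * real (q ^ l)) / real (q ^ l)"
        by (simp add: diff_divide_distrib)
      then have "norm (f l / real (q ^ l) - c) = \<bar>f l - c * real (q ^ l)\<bar> / real (q ^ l)"
        using pos by simp
      also have "\<dots> \<le> \<bar>e\<bar> / real (q ^ l)"
        using assms[of l] pos by (intro divide_right_mono) auto
      finally show "norm (f l / real (q ^ l) - c) \<le> norm (e / real (q ^ l)) * 1"
        using pos by (simp add: abs_divide)
    qed
  qed
  then show ?thesis
    by (rule LIM_zero_cancel)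
qed

text \<open>A digit expansion may end in repeated digits \<open>q - 1\<close>, so \<open>X\<close> may equal the right end of its
  elementary interval, and even \<open>1\<close>, which \<open>frac\<close> sends to \<open>0\<close>. The outer set therefore contains one
  extra interval on the left and the last interval.\<close>

lemma uniformly_distributed:
  assumes dens: "\<And>l S. (\<And>i. i < s \<Longrightarrow> S i \<subseteq> {..<q ^ l}) \<Longrightarrow>
    (\<lambda>N. real (card {k. k < N \<and> (\<forall>i<s. D l k i \<in> S i)}) / real N)
      \<longlonglongrightarrow> (\<Prod>i<s. real (card (S i)) / real (q ^ l))"
  shows "uniformly_distributed_mod1 s X"
  unfolding uniformly_distributed_mod1_def
proof (intro allI impI)
  fix a b :: "nat \<Rightarrow> real"
  assume ab: "\<forall>i<s. 0 \<le> a i \<and> a i < b i \<and> b i \<le> 1"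
  define A where "A l i = \<lceil>a i * real (q ^ l)\<rceil>" for l i
  define B where "B l i = \<lceil>b i * real (q ^ l)\<rceil>" for l i
  \<comment> \<open>Stopping before \<open>B l i - 1\<close> leaves room for a point at the right
    end of its interval: \<open>D + 1 <= B - 1\<close> still gives \<open>X < b\<close>.\<close>
  define inner where "inner l i = {nat (A l i)..<nat (B l i - 1)}" for l i
  define outer where "outer l i = insert (q ^ l - 1) {nat (A l i - 1)..<nat (B l i)}" for l i
  have Q: "real (q ^ l) > 0" for l
    using q by simp
  have AB: "0 \<le> A l i" "A l i \<le> B l i" "0 < B l i" "B l i \<le> int (q ^ l)"
    "real_of_int (A l i) - 1 < a i * real (q ^ l)" "a i * real (q ^ l) \<le> real_of_int (A l i)"
    "real_of_int (B l i) - 1 < b i * real (q ^ l)" "b i * real (q ^ l) \<le> real_of_int (B l i)"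
    if i: "i < s" for l i
  proof -
    have ai: "0 \<le> a i" "a i < b i" "b i \<le> 1"
      using ab i by auto
    have 0: "0 \<le> a i * real (q ^ l)" and 1: "a i * real (q ^ l) < b i * real (q ^ l)"
      and 2: "b i * real (q ^ l) \<le> real (q ^ l)"
      using ai Q[of l] mult_right_mono[of "b i" 1 "real (q ^ l)"] by simp_all
    show "0 \<le> A l i"
      unfolding A_def using 0 by linarith
    show "A l i \<le> B l i"
      unfolding A_def B_def using 1 by (intro ceiling_mono) simp
    show "0 < B l i"
      unfolding B_def using 0 1 by linarith
    show "B l i \<le> int (q ^ l)"
      unfolding B_def ceiling_le_iff using 2 by simp
    show "real_of_int (A l i) - 1 < a i * real (q ^ l)" "a i * real (q ^ l) \<le> real_of_int (A l i)"
      "real_of_int (B l i) - 1 < b i * real (q ^ l)" "b i * real (q ^ l) \<le> real_of_int (B l i)"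
      unfolding A_def B_def by linarith+
  qed
  have inner_sub: "inner l i \<subseteq> {..<q ^ l}" and outer_sub: "outer l i \<subseteq> {..<q ^ l}" if "i < s" for l i
  proof -
    have "nat (B l i) \<le> q ^ l" "nat (B l i - 1) \<le> nat (B l i)" "q ^ l > 0"
      using AB(4)[OF that, of l] q by (simp_all only: nat_le_iff nat_mono) simp_all
    then show "inner l i \<subseteq> {..<q ^ l}" and "outer l i \<subseteq> {..<q ^ l}"
      by (auto simp: inner_def outer_def)
  qed
  have in_inner: "frac (X k i) \<in> {a i..<b i}" if i: "i < s" and mem: "D l k i \<in> inner l i" for l k i
  proof -
    have "A l i \<le> int (D l k i)" "int (D l k i) < B l i - 1"
      using mem by (auto simp: inner_def)
    then have "real_of_int (A l i) \<le> real (D l k i)" "real (D l k i) + 1 \<le> real_of_int (B l i) - 1"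
      by linarith+
    then have "a i * real (q ^ l) \<le> X k i * real (q ^ l)" "X k i * real (q ^ l) < b i * real (q ^ l)"
      using AB[OF i, of l] lower[OF i, of l k] upper[OF i, of k l] by linarith+
    then have "a i \<le> X k i" "X k i < b i"
      using Q[of l] by simp_all
    then show ?thesis
      using frac_cases[OF i, of k] ab i by force
  qed
  have in_outer: "D l k i \<in> outer l i" if i: "i < s" and mem: "frac (X k i) \<in> {a i..<b i}" for l k i
    using frac_cases[OF i, of k]
  proof
    assume "X k i < 1 \<and> frac (X k i) = X k i"
    then have "a i * real (q ^ l) \<le> X k i * real (q ^ l)" "X k i * real (q ^ l) < b i * real (q ^ l)"
      using mem Q[of l] by auto
    then have "real_of_int (A l i) - 1 < real (D l k i) + 1" "real (D l k i) < real_of_int (B l i)"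
      using AB[OF i, of l] lower[OF i, of l k] upper[OF i, of k l] by linarith+
    then have "A l i - 1 \<le> int (D l k i)" "int (D l k i) < B l i"
      by linarith+
    then show ?thesis
      by (auto simp: outer_def nat_le_iff)
  next
    assume "X k i = 1 \<and> frac (X k i) = 0"
    then have "real (q ^ l) \<le> real (D l k i) + 1"
      using upper[OF i, of k l] by simp
    then have "q ^ l \<le> D l k i + 1"
      by linarith
    then have "D l k i = q ^ l - 1"
      using less[OF i, of l k] by simp
    then show ?thesis
      by (simp add: outer_def)
  qed
  have inner_lim: "(\<lambda>l. real (card (inner l i)) / real (q ^ l)) \<longlonglongrightarrow> b i - a i" if i: "i < s" for i
  \<comment> \<open>Rounding the ends and dropping an interval cost a number of intervals bounded
    independently of \<open>l\<close>, and division by \<open>q^l\<close> removes this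
    error.\<close>
  proof (rule tendsto_div_power_of_bounded_diff[where e = 3])
    fix l
    have "real (card (inner l i)) \<le> real_of_int (B l i) - real_of_int (A l i)"
      "real_of_int (B l i) - real_of_int (A l i) - 1 \<le> real (card (inner l i))"
      using AB[OF i, of l] by (auto simp: inner_def)
    then show "\<bar>real (card (inner l i)) - (b i - a i) * real (q ^ l)\<bar> \<le> 3"
      using AB[OF i, of l] by (simp add: left_diff_distrib abs_le_iff)
  qed
  have outer_lim: "(\<lambda>l. real (card (outer l i)) / real (q ^ l)) \<longlonglongrightarrow> b i - a i" if i: "i < s" for i
  proof (rule tendsto_div_power_of_bounded_diff[where e = 4])
    fix l
    let ?I = "{nat (A l i - 1)..<nat (B l i)}"
    have "card ?I \<le> card (outer l i)" "card (outer l i) \<le> Suc (card ?I)"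
      unfolding outer_def by (auto intro: card_mono card_insert_le_m1 simp: card_insert_if)
    moreover have "real (card ?I) \<le> real_of_int (B l i) - real_of_int (A l i) + 1"
      "real_of_int (B l i) - real_of_int (A l i) \<le> real (card ?I)"
      using AB[OF i, of l] by auto
    ultimately have "real (card (outer l i)) \<le> real_of_int (B l i) - real_of_int (A l i) + 2"
      "real_of_int (B l i) - real_of_int (A l i) \<le> real (card (outer l i))"
      by linarith+
    then show "\<bar>real (card (outer l i)) - (b i - a i) * real (q ^ l)\<bar> \<le> 4"
      using AB[OF i, of l] by (simp add: left_diff_distrib abs_le_iff)
  qed
  have card_le: "real (card {k. k < N \<and> P k}) / real N \<le> real (card {k. k < N \<and> P' k}) / real N"
    if "\<And>k. P k \<Longrightarrow> P' k" for P P' :: "nat \<Rightarrow> bool" and N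
  proof (rule divide_right_mono)
    show "real (card {k. k < N \<and> P k}) \<le> real (card {k. k < N \<and> P' k})"
      unfolding of_nat_le_iff by (rule card_mono) (auto simp: that)
  qed simp
  let ?f = "\<lambda>N. real (card {k. k < N \<and> (\<forall>i<s. frac (X k i) \<in> {a i..<b i})}) / real N"
  show "?f \<longlonglongrightarrow> (\<Prod>i<s. b i - a i)"
  \<comment> \<open>For each \<open>y\<close> a single fine enough level \<open>l\<close> is fixed
    first, and only then \<open>N\<close> grows; no interchange of the limits in \<open>l\<close>
    and \<open>N\<close> is involved.\<close>
  proof (rule order_tendstoI)
    fix y assume y: "y < (\<Prod>i<s. b i - a i)"
    have "(\<lambda>l. \<Prod>i<s. real (card (inner l i)) / real (q ^ l)) \<longlonglongrightarrow> (\<Prod>i<s. b i - a i)"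
      using inner_lim by (intro tendsto_prod) simp
    then have "\<forall>\<^sub>F l in sequentially. y < (\<Prod>i<s. real (card (inner l i)) / real (q ^ l))"
      using y by (rule order_tendstoD)
    then obtain l where l: "y < (\<Prod>i<s. real (card (inner l i)) / real (q ^ l))"
      using eventually_happens'[OF sequentially_bot] by blast
    have "\<forall>\<^sub>F N in sequentially. y < real (card {k. k < N \<and> (\<forall>i<s. D l k i \<in> inner l i)}) / real N"
      using order_tendstoD(1)[OF dens[of "inner l" l, OF inner_sub] l] by simp
    then show "\<forall>\<^sub>F N in sequentially. y < ?f N"
    proof eventually_elim
      case (elim N)
      then show ?case
        by (rule less_le_trans) (rule card_le, use in_inner in blast)
    qed
  next
    fix y assume y: "(\<Prod>i<s. b i - a i) < y"
    have "(\<lambda>l. \<Prod>i<s. real (card (outer l i)) / real (q ^ l)) \<longlonglongrightarrow> (\<Prod>i<s. b i - a i)"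
      using outer_lim by (intro tendsto_prod) simp
    then have "\<forall>\<^sub>F l in sequentially. (\<Prod>i<s. real (card (outer l i)) / real (q ^ l)) < y"
      using y by (rule order_tendstoD)
    then obtain l where l: "(\<Prod>i<s. real (card (outer l i)) / real (q ^ l)) < y"
      using eventually_happens'[OF sequentially_bot] by blast
    have "\<forall>\<^sub>F N in sequentially. real (card {k. k < N \<and> (\<forall>i<s. D l k i \<in> outer l i)}) / real N < y"
      using order_tendstoD(2)[OF dens[of "outer l" l, OF outer_sub] l] by simp
    then show "\<forall>\<^sub>F N in sequentially. ?f N < y"
    proof eventually_elim
      case (elim N)
      show ?case
        by (rule le_less_trans[OF _ elim]) (rule card_le, use in_outer in blast)
    qed
  qed
qed

end

context digit_bijection
begin

text \<open>The relation passes from the rows to the digits of every point, with the same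
  coefficients \<open>h\<close>. A pattern whose only nonzero digit, equal to 1, stands where
  \<open>h\<close> is nonzero violates it.\<close>

lemma row_relation_missing_prefix:
  assumes rel: "\<forall>c. (\<Sum>i<s. \<Sum>j<l. h i j * C i j c) = 0"
    and nz: "i\<^sub>0 < s" "j\<^sub>0 < l" "h i\<^sub>0 j\<^sub>0 \<noteq> 0"
  obtains d where "\<And>i. d i < CARD('a) ^ l" and "\<And>k. \<exists>i<s. prefix C l k i \<noteq> d i"
proof -
  define e where "e i j = (if i = i\<^sub>0 \<and> j = j\<^sub>0 then 1 else 0::'a)" for i j
  define d where "d i = prefix_num l (e i)" for i
  have "\<exists>i<s. prefix C l k i \<noteq> d i" for k
  proof (rule ccontr)
    assume "\<not> (\<exists>i<s. prefix C l k i \<noteq> d i)"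
    then have eq: "mat_digit \<phi> (C i) k j = e i j" if "i < s" "j < l" for i j
      using that digit_vec_prefix_num[of j l "mat_digit \<phi> (C i) k"] digit_vec_prefix_num[of j l "e i"]
      by (simp add: d_def)
    let ?S = "{c. digit_vec \<phi> k c \<noteq> 0}"
    have "(\<Sum>i<s. \<Sum>j<l. h i j * mat_digit \<phi> (C i) k j) =
      (\<Sum>i<s. \<Sum>j<l. \<Sum>c\<in>?S. h i j * C i j c * digit_vec \<phi> k c)"
      by (simp add: mat_digit_def sum_distrib_left mult.assoc)
    \<comment> \<open>The sum over the columns is moved outside, so that the relation applies to
      each column separately.\<close>
    also have "\<dots> = (\<Sum>i<s. \<Sum>c\<in>?S. \<Sum>j<l. h i j * C i j c * digit_vec \<phi> k c)"
      by (intro sum.cong refl sum.swap)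
    also have "\<dots> = (\<Sum>c\<in>?S. \<Sum>i<s. \<Sum>j<l. h i j * C i j c * digit_vec \<phi> k c)"
      by (rule sum.swap)
    also have "\<dots> = 0"
      using rel by (simp add: sum_distrib_right[symmetric])
    finally have "(\<Sum>i<s. \<Sum>j<l. h i j * e i j) = 0"
      by (simp add: eq)
    moreover have "(\<Sum>i<s. \<Sum>j<l. h i j * e i j) = (\<Sum>i<s. if i = i\<^sub>0 then h i j\<^sub>0 else 0)"
    proof (rule sum.cong[OF refl])
      fix i
      have "(\<Sum>j<l. h i j * e i j) = (\<Sum>j<l. if j = j\<^sub>0 then (if i = i\<^sub>0 then h i j else 0) else 0)"
        by (intro sum.cong) (auto simp: e_def)
      then show "(\<Sum>j<l. h i j * e i j) = (if i = i\<^sub>0 then h i j\<^sub>0 else 0)"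
        using nz by simp
    qed
    ultimately show False
      using nz by simp
  qed
  then show ?thesis
    using that[of d] prefix_num_less by (simp add: d_def)
qed

end

section \<open>Uniform distribution, independence of the rows and independence of the series\<close>

theorem theorem6:
  fixes s :: nat
    and \<phi> :: "nat \<Rightarrow> 'a::{field,finite}"
    and \<BB> :: "nat \<Rightarrow> nat \<Rightarrow> nat \<Rightarrow> 'a poly"
    and \<alpha> :: "nat \<Rightarrow> 'a fps"
    and X :: "nat \<Rightarrow> nat \<Rightarrow> real"
  assumes "s \<ge> 2"
    and "bij_betw \<phi> {..<CARD('a)} UNIV" and "\<phi> 0 = 0"
    and "compatible_bases s \<BB>"
    and "\<forall>i<s. \<alpha> i \<in> unit_series"
    and "hyperplane_sequence s \<phi> \<BB> \<alpha> X"
  shows "uniformly_distributed_mod1 s X \<longleftrightarrow> lin_indep_over_polys s \<alpha>"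
proof -
  interpret digit_bijection \<phi>
    using assms(2,3) by unfold_locales
  obtain C where space: "\<forall>m\<ge>1. vec_space.row_space (s * m) (overall_mat s C m) =
      vec_module.orthogonal_complement (s * m) (hyperplane_space s \<BB> \<alpha> m)"
    and X: "\<forall>k. \<forall>i<s. X k i = digital_sequence \<phi> C k i"
    using assms(6) unfolding hyperplane_sequence_def by blast
  \<comment> \<open>The expansion of each point gives its bounds at all levels, including expansions
    that end in repeated digits \<open>q - 1\<close>.\<close>
  interpret prefix_sequence s "CARD('a)" X "prefix C"
  proof
    show "CARD('a) \<ge> 2"
      by (rule CARD_field_ge_2)
    fix i l k assume i: "i < s"
    show "prefix C l k i < CARD('a) ^ l"
      by (rule prefix_num_less)
    show "real (prefix C l k i) \<le> X k i * real (CARD('a) ^ l)"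
      and "X k i * real (CARD('a) ^ l) \<le> real (prefix C l k i) + 1"
      using digit_series_bounds[OF CARD_field_ge_2, of "\<lambda>j. \<psi> (mat_digit \<phi> (C i) k j)", OF psi_less]
        X i by (simp_all only: digital_sequence_def prefix_num_def)
  qed
  have "uniformly_distributed_mod1 s X \<longleftrightarrow>
    (\<forall>l h. (\<forall>c. (\<Sum>i<s. \<Sum>j<l. h i j * C i j c) = 0) \<longrightarrow> (\<forall>i<s. \<forall>j<l. h i j = 0))"
    (is "?U \<longleftrightarrow> ?I")
  proof
    assume ?I
    then show ?U
      by (intro uniformly_distributed prefix_density) blast+
  next
    assume U: ?U
    show ?I
    proof (intro allI impI, rule ccontr)
      fix l h i j
      assume rel: "\<forall>c. (\<Sum>i<s. \<Sum>j<l. h i j * C i j c) = 0"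
        and nz: "i < s" "j < l" "h i j \<noteq> 0"
      show False
      proof (rule row_relation_missing_prefix[OF rel nz])
        fix d assume "\<And>i. d i < CARD('a) ^ l" and "\<And>k. \<exists>i<s. prefix C l k i \<noteq> d i"
        then show False
          using not_uniformly_distributed U by blast
      qed
    qed
  qed
  also have "\<dots> \<longleftrightarrow> lin_indep_over_polys s \<alpha>"
    by (rule rows_independent_iff_lin_indep[OF assms(4) space])
  finally show ?thesis .
qed

end
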